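(* Let $p,q\ge 1$ be integers, let $A_1,\dots,A_p>0$, $B_1,\dots,B_q>0$, and let $a_1,\dots,a_p,b_1,\dots,b_q$ be real. Put $$\gamma=-\min_{1\le k\le p}(a_k/A_k),\qquad \rho=\prod_{k=1}^{p}A_k^{A_k}\prod_{j=1}^{q}B_j^{-B_j},\qquad \mu=\sum_{j=1}^{q}b_j-\sum_{k=1}^{p}a_k+\frac{p-q}{2}.$$ Suppose $\mu>0$ and $\sum_{i=1}^{p}A_i=\sum_{j=1}^{q}B_j$. Then, for $c>\gamma$, the integral $$H(x)=H^{p,0}_{q,p}\left(x\left|\begin{array}{l}(\mathbf B,\mathbf b)\\(\mathbf A,\mathbf a)\end{array}\right.\right)=\frac{1}{2\pi i}\int_{c-i\infty}^{c+i\infty}\frac{\prod_{k=1}^{p}\Gamma(A_ks+a_k)}{\prod_{j=1}^{q}\Gamma(B_js+b_j)}x^{-s}\,ds$$ converges for all $x>0$ except possibly for $x=\rho$, and $H(x)=0$ for all $x>\rho$. Moreover, the Mellin transform of $H$ exists for $\Re s>\gamma$ and $$\int_{0}^{\rho}H(x)\,x^{s-1}\,dx=\frac{\prod_{k=1}^{p}\Gamma(A_ks+a_k)}{\prod_{j=1}^{q}\Gamma(B_js+b_j)},\qquad \Re s>\gamma.$$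
   Context: The function $H$ is (a particular case of) Fox's $H$-function. The integral along the vertical line $\Re s=c$, traversed upwards, is understood as the improper integral $\lim_{R\to\infty}\int_{c-iR}^{c+iR}$. *)

theory Defs
  imports "HOL-Complex_Analysis.Complex_Analysis"
begin

definition has_vertical_line_integral :: "(complex \<Rightarrow> complex) \<Rightarrow> real \<Rightarrow> complex \<Rightarrow> bool" where
  "has_vertical_line_integral f c I \<longleftrightarrow>
     (\<forall>R>0. f contour_integrable_on linepath (Complex c (-R)) (Complex c R)) \<and>
     ((\<lambda>R. contour_integral (linepath (Complex c (-R)) (Complex c R)) f) \<longlongrightarrow> I) at_top"

definition vertical_line_integral :: "(complex \<Rightarrow> complex) \<Rightarrow> real \<Rightarrow> complex" where
  "vertical_line_integral f c = (THE I. has_vertical_line_integral f c I)"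

text \<open>
  The library sets \<open>Gamma z = 0\<close> at the poles of the Gamma function, and division by zero gives zero.
  So where a factor of the denominator has a pole and no factor of the numerator does (in particular
  everywhere to the right of the poles of the numerator), the quotient has the value 0 that the
  usual convention \<open>1 / \<Gamma> = 0\<close> assigns to it.
\<close>
definition gamma_quotient ::
  "nat \<Rightarrow> (nat \<Rightarrow> real) \<Rightarrow> (nat \<Rightarrow> real) \<Rightarrow> nat \<Rightarrow> (nat \<Rightarrow> real) \<Rightarrow> (nat \<Rightarrow> real) \<Rightarrow> complex \<Rightarrow> complex" where
  "gamma_quotient p A a q B b s =
     (\<Prod>k=1..p. Gamma (of_real (A k) * s + of_real (a k))) /
     (\<Prod>j=1..q. Gamma (of_real (B j) * s + of_real (b j)))"

definition fox_H_integrand ::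
  "nat \<Rightarrow> (nat \<Rightarrow> real) \<Rightarrow> (nat \<Rightarrow> real) \<Rightarrow> nat \<Rightarrow> (nat \<Rightarrow> real) \<Rightarrow> (nat \<Rightarrow> real) \<Rightarrow> real \<Rightarrow> complex \<Rightarrow> complex" where
  "fox_H_integrand p A a q B b x s = gamma_quotient p A a q B b s * of_real x powr (- s)"

text \<open>The function \<open>H\<^sup>p\<^sup>,\<^sup>0\<^sub>q\<^sub>,\<^sub>p\<close>, with the abscissa \<open>c\<close> of the line of integration as an explicit argument.\<close>
definition fox_H ::
  "nat \<Rightarrow> (nat \<Rightarrow> real) \<Rightarrow> (nat \<Rightarrow> real) \<Rightarrow> nat \<Rightarrow> (nat \<Rightarrow> real) \<Rightarrow> (nat \<Rightarrow> real) \<Rightarrow> real \<Rightarrow> real \<Rightarrow> complex" where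
  "fox_H p A a q B b c x =
     1 / (2 * of_real pi * \<i>) * vertical_line_integral (fox_H_integrand p A a q B b x) c"

end

theory Submission
  imports Defs "HOL-Library.Landau_Symbols"
begin

text \<open>
  Let \<open>\<beta> = ln \<rho>\<close>, let \<open>Q\<close> be the quotient of Gamma products, and put \<open>F z = Q z * exp (- \<beta> * z)\<close> and
  \<open>\<tau> = ln (\<rho> / x)\<close>. The integrand of \<open>H\<close> is then \<open>F z * exp (\<tau> * z)\<close>. So, as a function of \<open>\<tau>\<close>, \<open>H\<close> is the
  inverse Laplace transform of \<open>F\<close>, and the claim is that the inversion integral converges for
  \<open>\<tau> \<noteq> 0\<close>, vanishes for \<open>\<tau> < 0\<close>, and is carried back to \<open>F\<close> by the Laplace transform.

  For \<open>\<mu> \<le> 1\<close> the inversion integral converges only conditionally. All the analysis is therefore done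
  with \<open>F'\<close> in place of \<open>F\<close>: on every half-plane \<open>Re z \<ge> c\<close> with \<open>c > \<gamma>\<close> one has \<open>F z = O(|z| powr (-\<mu>))\<close> and
  \<open>F' z = O(|z| powr (-\<mu> - 1))\<close>, so \<open>F'\<close> is absolutely integrable along vertical lines. Integration by
  parts, whose boundary terms vanish, gives
  \<open>\<integral> F z * exp (\<tau> * z) dz = - (1 / \<tau>) * \<integral> F' z * exp (\<tau> * z) dz\<close>
  and hence the convergence (\<open>has_vertical_line_integral_by_parts\<close>). By Cauchy's theorem the integral with
  \<open>F'\<close> does not depend on the abscissa \<open>c\<close>. For \<open>\<tau> \<le> 0\<close> the limit \<open>c \<rightarrow> \<infinity>\<close> shows that it is zero; for \<open>\<tau> > 0\<close>
  the abscissa \<open>c + 1 / \<tau>\<close> bounds it by a multiple of \<open>\<tau> powr \<mu> * exp (c * \<tau>)\<close>. After the division by \<open>\<tau>\<close>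
  this leaves the singularity \<open>\<tau> powr (\<mu> - 1)\<close> at \<open>x = \<rho>\<close>, which is integrable because \<open>\<mu> > 0\<close>.

  The Laplace transform of the integral with \<open>F'\<close> is computed by Fubini's theorem and Cauchy's
  integral formula (\<open>laplace_deriv_inversion\<close>). Dividing by \<open>\<tau>\<close> amounts to integrating the Laplace
  transform from \<open>s\<close> to \<open>s + \<infinity>\<close>, which leads from \<open>F'\<close> back to \<open>F\<close> (\<open>laplace_inversion\<close>). The substitution
  \<open>x = \<rho> * exp (- \<tau>)\<close> turns this into the statement on the Mellin transform.

  The decay of \<open>F\<close> is read off its logarithmic derivative. Here \<open>F' / F\<close> is a combination of digamma functions of affine arguments, and
  \<open>Digamma z = Ln z - 1 / (2 * z) + O(1 / z\<^sup>2)\<close>. The logarithms cancel because \<open>\<Sum>A = \<Sum>B\<close>, the constants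
  cancel by the choice of \<open>\<beta>\<close>, and \<open>F' z / F z = - \<mu> / z + O(1 / z\<^sup>2)\<close> remains; integration along rays
  yields the bound for \<open>F\<close> (\<open>gamma_quotient_decay\<close>).
\<close>

section \<open>The digamma function in the right half-plane\<close>

text \<open>
  The subtracted term is the trapezoidal approximation to the integral of \<open>1 / z\<close> from \<open>1\<close> to \<open>1 + w\<close>. The
  difference vanishes at \<open>w = 0\<close> and has derivative \<open>- (w / (1 + w))\<^sup>2 / 2\<close>, where \<open>|1 + w| \<ge> 1\<close>.
\<close>
lemma norm_Ln_minus_trapezoid_le:
  fixes w :: complex
  assumes "Re w \<ge> 0"
  shows "norm (Ln (1 + w) - (w + w / (1 + w)) / 2) \<le> norm w ^ 3 / 2"
proof -
  let ?f = "\<lambda>w::complex. Ln (1 + w) - (w + w / (1 + w)) / 2"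
  let ?f' = "\<lambda>w::complex. - (w / (1 + w))\<^sup>2 / 2"
  have re: "Re x \<ge> 0 \<and> norm x \<le> norm w" if "x \<in> closed_segment 0 w" for x
    using that assms by (auto simp: in_segment mult_left_le_one_le)
  have nz: "1 + x \<noteq> 0" if "Re x \<ge> 0" for x :: complex
    using that by (metis add.right_neutral add_cancel_right_left add_nonneg_eq_0_iff one_complex.sel(1) plus_complex.sel(1) zero_complex.sel(1) zero_le_one zero_neq_one)
  have der: "(?f has_field_derivative ?f' x) (at x within closed_segment 0 w)"
    if "x \<in> closed_segment 0 w" for x
  proof -
    have "Re x \<ge> 0" using re[OF that] by simp
    hence "1 + x \<noteq> 0" "1 + x \<notin> \<real>\<^sub>\<le>\<^sub>0" using nz
      by (auto simp: complex_nonpos_Reals_iff)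
    moreover define d where "d = 1 + x"
    ultimately have d: "d \<noteq> 0" "d \<notin> \<real>\<^sub>\<le>\<^sub>0" "x = d - 1" by auto
    have "1 / d - (1 + (d - x) / (d * d)) / 2 = - (x / d)\<^sup>2 / 2"
      using d by (simp add: divide_simps power2_eq_square) (simp add: algebra_simps)
    hence "inverse d - (2 + 2 / (d * d)) / 4 = - ((x / d)\<^sup>2 / 2)"
      using d(3) by (simp add: inverse_eq_divide add_divide_distrib mult_ac)
    thus ?thesis using d(1,2) unfolding d_def
      by (auto intro!: derivative_eq_intros)
  qed
  have bd: "norm (?f' x) \<le> norm w ^ 2 / 2" if "x \<in> closed_segment 0 w" for x
  proof -
    have x: "Re x \<ge> 0" "norm x \<le> norm w" using re[OF that] by auto
    have "1 \<le> Re (1 + x)" using x by simp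
    also have "\<dots> \<le> norm (1 + x)" by (rule complex_Re_le_cmod)
    finally have "norm x / norm (1 + x) \<le> norm x"
      by (auto simp: divide_simps mult_le_cancel_left1)
    also note x(2)
    finally show ?thesis
      by (auto simp: norm_divide norm_power intro!: divide_right_mono power_mono)
  qed
  have "norm (?f w - ?f 0) \<le> norm w ^ 2 / 2 * norm (w - 0)"
    by (rule field_differentiable_bound[OF convex_closed_segment der bd]) auto
  thus ?thesis by (simp add: power3_eq_cube power2_eq_square)
qed

text \<open>
  The two arguments on the right lie in \<open>[-\<pi>/2, \<pi>/2]\<close> and in \<open>(-\<pi>/2, \<pi>/2)\<close>, so their sum stays in the
  range of the principal branch.
\<close>
lemma Ln_add_nonneg_real:
  fixes z :: complex
  assumes "Re z \<ge> 0" "z \<noteq> 0" "b \<ge> 0"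
  shows "Ln (z + of_real b) = Ln z + Ln (1 + of_real b / z)"
proof -
  have re: "Re (of_real b / z) \<ge> 0"
    using assms by (auto simp: Re_divide intro!: divide_nonneg_nonneg mult_nonneg_nonneg)
  hence pos: "Re (1 + of_real b / z) > 0" by simp
  hence nz: "1 + of_real b / z \<noteq> 0" by (metis less_irrefl zero_complex.sel(1))
  have i1: "\<bar>Im (Ln z)\<bar> \<le> pi / 2" using assms Re_Ln_pos_le[of z] by blast
  have i2: "\<bar>Im (Ln (1 + of_real b / z))\<bar> < pi / 2" using pos nz Re_Ln_pos_lt by blast
  have "Ln (z * (1 + of_real b / z)) = Ln z + Ln (1 + of_real b / z)"
    using i1 i2 by (intro Ln_times_simple assms nz) auto
  thus ?thesis using assms by (simp add: algebra_simps)
qed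

text \<open>
  Telescoping: \<open>1 / x ^ 3 \<le> 1 / (x - 1)\<^sup>2 - 1 / x\<^sup>2\<close> for \<open>x \<ge> 2\<close>.
\<close>
lemma sum_inverse_cube_le:
  fixes r :: real
  assumes "r \<ge> 2"
  shows "(\<Sum>n<m. 1 / (r + real n) ^ 3) \<le> 1 / (r - 1)\<^sup>2 - 1 / (r + real m - 1)\<^sup>2"
proof (induction m)
  case (Suc m)
  define x where "x = r + real m"
  have x: "x \<ge> 2" using assms by (simp add: x_def)
  have "1 / x ^ 3 \<le> 1 / (x - 1)\<^sup>2 - 1 / x\<^sup>2"
  proof -
    have "1 / (x - 1)\<^sup>2 - 1 / x\<^sup>2 - 1 / x ^ 3 = (x\<^sup>2 + x - 1) / (x ^ 3 * (x - 1)\<^sup>2)"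
    proof -
      define y where "y = x - 1"
      have "y > 0" "x = y + 1" using x by (auto simp: y_def)
      moreover from this have "y + 1 \<noteq> 0" by linarith
      ultimately show ?thesis
        by (simp add: divide_simps power2_eq_square power3_eq_cube) (simp add: algebra_simps)
    qed
    also have "\<dots> \<ge> 0"
    proof (intro divide_nonneg_nonneg mult_nonneg_nonneg)
      show "0 \<le> x\<^sup>2 + x - 1" using x zero_le_power2[of x] by linarith
    qed (use x in auto)
    finally show ?thesis by simp
  qed
  with Suc show ?case by (simp add: x_def)
qed auto

text \<open>
  The difference is the sum over \<open>n\<close> of the trapezoidal errors on the segments from \<open>z + n\<close> to \<open>z + n + 1\<close>.
  Each of them is \<open>O(1 / |z + n| ^ 3)\<close> and \<open>|z| + n \<le> 2 * |z + n|\<close>, so the sum is \<open>O(1 / |z|\<^sup>2)\<close>. The remainder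
  after \<open>m\<close> terms tends to zero by the limit representation of the digamma function.
\<close>
lemma norm_Digamma_minus_Ln_le:
  fixes z :: complex
  assumes z: "Re z \<ge> 0" "norm z \<ge> 2"
  shows "norm (Digamma z - (Ln z - 1 / (2 * z))) \<le> 16 / norm z ^ 2"
proof -
  have z0: "z \<noteq> 0" using z by auto
  define T where "T = (\<lambda>z::complex. Ln (1 + 1 / z) - (1 / z + 1 / (z + 1)) / 2)"
  have nz: "z + of_nat n \<noteq> 0" "z + of_nat n + 1 \<noteq> 0" for n
    using z z0 by (auto simp: complex_eq_iff)
  have S: "(\<Sum>n<m. T (z + of_nat n)) = Ln (z + of_nat m) - Ln z
            - (\<Sum>n<m. inverse (z + of_nat n)) + 1 / (2 * z) - 1 / (2 * (z + of_nat m))" for m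
  proof (induction m)
    case (Suc m)
    have L: "Ln (z + of_nat m + of_real 1) = Ln (z + of_nat m) + Ln (1 + of_real 1 / (z + of_nat m))"
      by (rule Ln_add_nonneg_real) (use z nz[of m] in auto)
    have T: "T (z + of_nat m) = Ln (z + of_nat (Suc m)) - Ln (z + of_nat m)
        - inverse (z + of_nat m) + 1 / (2 * (z + of_nat m)) - 1 / (2 * (z + of_nat (Suc m)))"
    proof -
      have "inverse u = 1 / (2 * u) + 1 / (2 * u)" for u :: complex
        by (cases "u = 0") (auto simp: field_simps)
      from this[of "z + of_nat m"] show ?thesis using L
        by (simp add: T_def add_ac add_divide_distrib mult.commute[of _ 2] distrib_left)
    qed
    show ?case by (simp only: sum.lessThan_Suc Suc T) simp
  qed auto
  \<comment> \<open>\<open>|z| + n \<le> 2 * |z + n|\<close> follows from \<open>|z + n|\<^sup>2 \<ge> |z|\<^sup>2 + n\<^sup>2\<close>, where \<open>Re z \<ge> 0\<close> enters.\<close>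
  have bd: "norm (T (z + of_nat n)) \<le> 4 * (1 / (norm z + real n) ^ 3)" for n
  proof -
    let ?u = "z + of_nat n"
    have "Re (1 / ?u) \<ge> 0"
      using z by (auto simp: Re_divide intro!: divide_nonneg_nonneg mult_nonneg_nonneg)
    from norm_Ln_minus_trapezoid_le[OF this]
    moreover have "1 / ?u / (1 + 1 / ?u) = 1 / (?u + 1)" using nz[of n]
      by (simp add: divide_simps)
    ultimately have "norm (T ?u) \<le> norm (1 / ?u) ^ 3 / 2" by (simp add: T_def)
    also have "(norm z + real n)\<^sup>2 \<le> (2 * norm ?u)\<^sup>2"
    proof -
      have "(norm z)\<^sup>2 + (real n)\<^sup>2 \<le> (norm ?u)\<^sup>2"
        unfolding cmod_power2 using z by (simp add: power2_eq_square algebra_simps)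
      hence ge: "2 * ((norm z)\<^sup>2 + (real n)\<^sup>2) \<le> 2 * (norm ?u)\<^sup>2" by simp
      have "0 \<le> (norm z - real n)\<^sup>2" by simp
      hence "(norm z + real n)\<^sup>2 \<le> 2 * ((norm z)\<^sup>2 + (real n)\<^sup>2)"
        by (simp add: power2_eq_square algebra_simps)
      also note ge
      also have "2 * (norm ?u)\<^sup>2 \<le> (2 * norm ?u)\<^sup>2" by (simp add: power_mult_distrib)
      finally show ?thesis .
    qed
    hence "norm z + real n \<le> 2 * norm ?u" by (rule power2_le_imp_le) auto
    hence "1 / norm ?u \<le> 2 / (norm z + real n)" using z nz[of n]
      by (simp add: field_simps add_nonneg_pos)
    hence "norm (1 / ?u) ^ 3 / 2 \<le> (2 / (norm z + real n)) ^ 3 / 2"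
      by (intro divide_right_mono power_mono) (auto simp: norm_divide)
    finally show ?thesis by (simp add: power_divide)
  qed
  have le: "norm (\<Sum>n<m. T (z + of_nat n)) \<le> 16 / norm z ^ 2" for m
  proof -
    have "norm (\<Sum>n<m. T (z + of_nat n)) \<le> (\<Sum>n<m. 4 * (1 / (norm z + real n) ^ 3))"
      by (rule sum_norm_le) (use bd in auto)
    also have "\<dots> = 4 * (\<Sum>n<m. 1 / (norm z + real n) ^ 3)" by (simp add: sum_distrib_left)
    also have "\<dots> \<le> 4 * (1 / (norm z - 1)\<^sup>2)"
      using sum_inverse_cube_le[OF z(2), of m]
      by (smt (verit) divide_nonneg_nonneg zero_le_power2 mult_left_mono)
    also have "\<dots> \<le> 4 * (1 / (norm z / 2)\<^sup>2)"
      using z by (intro mult_left_mono divide_left_mono power_mono mult_pos_pos zero_less_power) auto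
    finally show ?thesis by (simp add: power_divide)
  qed
  have "(\<lambda>m. Ln (1 + z / of_nat m)) \<longlonglongrightarrow> Ln (1 + 0)"
    by (intro tendsto_intros tendsto_divide_0[OF tendsto_const])
       (auto intro!: tendsto_of_nat simp: complex_nonpos_Reals_iff)
  hence l1: "(\<lambda>m. Ln (1 + z / of_nat m)) \<longlonglongrightarrow> 0" by simp
  have l2: "(\<lambda>m. 1 / (2 * (z + of_nat m))) \<longlonglongrightarrow> 0"
    by (intro tendsto_divide_0[OF tendsto_const] tendsto_mult_filterlim_at_infinity[of _ 2]
        tendsto_add_filterlim_at_infinity[OF tendsto_const] tendsto_of_nat) auto
  have "(\<lambda>m. ((of_real (ln (real m)) - (\<Sum>n<m. inverse (z + of_nat n)))
      + Ln (1 + z / of_nat m) - Ln z + 1 / (2 * z)) - 1 / (2 * (z + of_nat m)))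
     \<longlonglongrightarrow> (Digamma z + 0 - Ln z + 1 / (2 * z)) - 0"
    by (intro tendsto_intros l1 l2 Digamma_LIMSEQ z0)
  also have "?this \<longleftrightarrow> (\<lambda>m. \<Sum>n<m. T (z + of_nat n)) \<longlonglongrightarrow> Digamma z + 0 - Ln z + 1 / (2 * z) - 0"
  proof (rule tendsto_cong)
    show "\<forall>\<^sub>F m in sequentially. of_real (ln (real m)) - (\<Sum>n<m. inverse (z + of_nat n))
      + Ln (1 + z / of_nat m) - Ln z + 1 / (2 * z) - 1 / (2 * (z + of_nat m)) = (\<Sum>n<m. T (z + of_nat n))"
      using eventually_gt_at_top[of 0]
    proof eventually_elim
      case (elim m)
      have "Re (1 + z / of_nat m) > 0" using z elim by (auto simp: Re_divide_of_nat add_pos_nonneg)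
      hence "1 + z / of_nat m \<noteq> 0" by (metis less_irrefl zero_complex.sel(1))
      hence "Ln (of_real (real m) * (1 + z / of_nat m)) = of_real (ln (real m)) + Ln (1 + z / of_nat m)"
        using Ln_times_of_real[of "real m" "1 + z / of_nat m"] elim by (simp add: Ln_of_real)
      also have "of_real (real m) * (1 + z / of_nat m) = z + of_nat m"
        using elim by (simp add: field_simps)
      finally show ?case unfolding S by simp
    qed
  qed
  finally have "(\<lambda>m. \<Sum>n<m. T (z + of_nat n)) \<longlonglongrightarrow> Digamma z - (Ln z - 1 / (2 * z))" by (simp add: algebra_simps)
  from Lim_bounded[OF tendsto_norm[OF this], of 0] show ?thesis using le by auto
qed

text \<open>
  The filter \<open>z \<rightarrow> \<infinity>\<close> within the closed right half-plane. The bounds below have to hold uniformly in this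
  whole region, because integration lines are moved to the right without limit.
\<close>
definition half_plane_inf :: "complex filter" where
  "half_plane_inf = inf at_infinity (principal {z. Re z \<ge> 0})"

lemma eventually_half_plane_inf:
  "eventually P half_plane_inf \<longleftrightarrow> (\<exists>R. \<forall>z. Re z \<ge> 0 \<and> norm z \<ge> R \<longrightarrow> P z)"
  by (auto simp: half_plane_inf_def eventually_inf_principal eventually_at_infinity)

lemma eventually_half_plane_infI:
  "(\<And>z. Re z \<ge> 0 \<Longrightarrow> norm z \<ge> R \<Longrightarrow> P z) \<Longrightarrow> eventually P half_plane_inf"
  by (auto simp: eventually_half_plane_inf)

lemma norm_affine_ge:
  fixes z :: complex
  assumes "B > 0" "norm z \<ge> 2 * \<bar>b\<bar> / B"
  shows "B * norm z / 2 \<le> norm (of_real B * z + of_real b)"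
proof -
  have "norm (of_real B * z) - norm (complex_of_real b) \<le> norm (of_real B * z + of_real b)"
    by (rule norm_diff_ineq)
  thus ?thesis using assms by (simp add: norm_mult field_simps)
qed

lemma inverse_affine_bigo:
  assumes B: "B > 0"
  shows "(\<lambda>z::complex. 1 / (of_real B * z) - 1 / (of_real B * z + of_real b))
           \<in> O[half_plane_inf](\<lambda>z. 1 / z\<^sup>2)"
proof (rule bigoI[where c = "2 * \<bar>b\<bar> / B\<^sup>2"],
       rule eventually_half_plane_infI[where R = "2 * \<bar>b\<bar> / B + 1"])
  fix z :: complex assume z: "norm z \<ge> 2 * \<bar>b\<bar> / B + 1"
  have "2 * \<bar>b\<bar> / B \<ge> 0" using B by simp
  hence nz: "norm z > 0" using z by linarith
  let ?w = "of_real B * z + of_real b"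
  have ge: "norm ?w \<ge> B * norm z / 2" by (rule norm_affine_ge) (use B z in auto)
  hence w: "norm ?w > 0" using nz B by (smt (verit) half_gt_zero mult_pos_pos)
  hence "1 / (of_real B * z) - 1 / ?w = of_real b / (of_real B * z * ?w)"
    using B nz by (subst diff_frac_eq) auto
  hence "norm (1 / (of_real B * z) - 1 / ?w) = \<bar>b\<bar> / (B * norm z * norm ?w)"
    using B by (simp add: norm_divide norm_mult)
  also have "\<dots> \<le> \<bar>b\<bar> / (B * norm z * (B * norm z / 2))"
    using ge nz B w by (intro divide_left_mono mult_left_mono mult_pos_pos) auto
  also have "\<dots> = 2 * \<bar>b\<bar> / B\<^sup>2 * norm (1 / z\<^sup>2)"
    by (simp add: norm_divide norm_mult power2_eq_square mult_ac)
  finally show "norm (1 / (of_real B * z) - 1 / ?w) \<le> 2 * \<bar>b\<bar> / B\<^sup>2 * norm (1 / z\<^sup>2)" .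
qed

text \<open>
  For \<open>b \<ge> 0\<close> the point \<open>B * z + b\<close> stays in the right half-plane, where \<open>norm_Digamma_minus_Ln_le\<close> applies; it
  remains to expand \<open>Ln (B * z + b)\<close> and \<open>1 / (B * z + b)\<close> up to \<open>O(1 / z\<^sup>2)\<close>.
\<close>
lemma Digamma_affine_bigo_nonneg:
  assumes B: "B > 0" and b: "b \<ge> 0"
  shows "(\<lambda>z. Digamma (of_real B * z + of_real b)
            - (of_real (ln B) + Ln z + of_real (b - 1 / 2) / (of_real B * z)))
           \<in> O[half_plane_inf](\<lambda>z. 1 / z\<^sup>2)"
proof -
  let ?w = "\<lambda>z. of_real B * z + of_real b :: complex"
  have w: "norm (?w z) \<ge> B * norm z" if "Re z \<ge> 0" for z
  proof (rule power2_le_imp_le)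
    have "(B * norm z)\<^sup>2 = (B * Re z)\<^sup>2 + (B * Im z)\<^sup>2"
      by (simp add: power_mult_distrib cmod_power2 algebra_simps)
    also have "\<dots> \<le> (B * Re z + b)\<^sup>2 + (B * Im z)\<^sup>2"
      using B b that by (intro add_right_mono power_mono) auto
    also have "\<dots> = (norm (?w z))\<^sup>2" by (simp add: cmod_power2)
    finally show "(B * norm z)\<^sup>2 \<le> (norm (?w z))\<^sup>2" .
  qed auto
  have "(\<lambda>z. Digamma (?w z) - (Ln (?w z) - 1 / (2 * ?w z))) \<in> O[half_plane_inf](\<lambda>z. 1 / z\<^sup>2)"
  proof (rule bigoI[where c = "16 / B\<^sup>2"], rule eventually_half_plane_infI[where R = "2 / B"])
    fix z :: complex assume z: "Re z \<ge> 0" "norm z \<ge> 2 / B"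
    have "2 \<le> B * norm z" using z(2) B by (simp add: field_simps)
    hence "norm (Digamma (?w z) - (Ln (?w z) - 1 / (2 * ?w z))) \<le> 16 / norm (?w z) ^ 2"
      using w[OF z(1)] z B b by (intro norm_Digamma_minus_Ln_le) auto
    also have "\<dots> \<le> 16 / (B * norm z) ^ 2"
      using w[OF z(1)] B \<open>2 \<le> B * norm z\<close>
      by (intro divide_left_mono power_mono mult_pos_pos zero_less_power) auto
    also have "\<dots> = 16 / B\<^sup>2 * norm (1 / z\<^sup>2)"
      by (simp add: norm_divide norm_power power_mult_distrib)
    finally show "norm (Digamma (?w z) - (Ln (?w z) - 1 / (2 * ?w z))) \<le> 16 / B\<^sup>2 * norm (1 / z\<^sup>2)" .
  qed
  moreover have "(\<lambda>z. Ln (?w z) - (of_real (ln B) + Ln z + of_real b / (of_real B * z)))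
      \<in> O[half_plane_inf](\<lambda>z. 1 / z\<^sup>2)"
  proof (rule bigoI[where c = "2 * (b / B)\<^sup>2"],
         rule eventually_half_plane_infI[where R = "2 * b / B + 1"])
    fix z :: complex assume z: "Re z \<ge> 0" "norm z \<ge> 2 * b / B + 1"
    have "2 * b / B \<ge> 0" using B b by simp
    hence nz: "norm z > 0" using z(2) by linarith
    define x where "x = of_real (b / B) / z"
    have x: "norm x \<le> 1 / 2" using z(2) nz B b by (simp add: x_def norm_divide norm_mult field_simps)
    have "Ln (?w z) = Ln (of_real B * z) + Ln (1 + x)"
      using Ln_add_nonneg_real[of "of_real B * z" b] z nz B b by (simp add: x_def)
    also have "Ln (of_real B * z) = of_real (ln B) + Ln z"
      using Ln_times_of_real[OF B, of z] nz B by (simp add: Ln_of_real)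
    finally have "Ln (?w z) - (of_real (ln B) + Ln z + of_real b / (of_real B * z)) = Ln (1 + x) - x"
      by (simp add: x_def)
    also have "norm \<dots> \<le> (norm x)\<^sup>2 / (1 - norm x)" using x by (intro Ln_approx_linear) auto
    also have "\<dots> \<le> (norm x)\<^sup>2 / (1 / 2)" using x by (intro divide_left_mono mult_pos_pos) auto
    also have "\<dots> = 2 * (b / B)\<^sup>2 * norm (1 / z\<^sup>2)"
      using B b by (simp add: x_def norm_divide norm_mult norm_power power_divide power_mult_distrib)
    finally show "norm (Ln (?w z) - (of_real (ln B) + Ln z + of_real b / (of_real B * z)))
       \<le> 2 * (b / B)\<^sup>2 * norm (1 / z\<^sup>2)" .
  qed
  moreover have "(\<lambda>z. 1 / 2 * (1 / (of_real B * z) - 1 / ?w z)) \<in> O[half_plane_inf](\<lambda>z. 1 / z\<^sup>2)"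
    using inverse_affine_bigo[OF B, of b] by (rule landau_o.big.cmult_in_iff[THEN iffD2, rotated]) auto
  ultimately have "(\<lambda>z. (Digamma (?w z) - (Ln (?w z) - 1 / (2 * ?w z)))
     + (Ln (?w z) - (of_real (ln B) + Ln z + of_real b / (of_real B * z)))
     + 1 / 2 * (1 / (of_real B * z) - 1 / ?w z)) \<in> O[half_plane_inf](\<lambda>z. 1 / z\<^sup>2)"
    by (intro sum_in_bigo(1))
  thus ?thesis by (rule landau_o.big.in_cong[THEN iffD1, rotated])
     (auto intro!: always_eventually simp: diff_divide_distrib right_diff_distrib)
qed

text \<open>
  A negative shift \<open>b\<close>, which moves the argument out of the right half-plane, is reduced to \<open>b + n \<ge> 0\<close>
  by the recurrence \<open>Digamma (w + 1) = Digamma w + 1 / w\<close>. Each step changes the expansion by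
  \<open>1 / (B * z) - 1 / (B * z + b)\<close> only.
\<close>
lemma Digamma_affine_bigo:
  assumes B: "B > 0"
  shows "(\<lambda>z. Digamma (of_real B * z + of_real b)
            - (of_real (ln B) + Ln z + of_real (b - 1 / 2) / (of_real B * z)))
           \<in> O[half_plane_inf](\<lambda>z. 1 / z\<^sup>2)"
proof -
  have "b + real n \<ge> 0 \<Longrightarrow> ?thesis" for n
  proof (induction n arbitrary: b)
    case 0
    thus ?case using Digamma_affine_bigo_nonneg[OF B] by simp
  next
    case (Suc n)
    let ?w = "\<lambda>z. of_real B * z + of_real b :: complex"
    have "(\<lambda>z. (Digamma (of_real B * z + of_real (b + 1))
            - (of_real (ln B) + Ln z + of_real (b + 1 - 1 / 2) / (of_real B * z)))
            + (1 / (of_real B * z) - 1 / ?w z)) \<in> O[half_plane_inf](\<lambda>z. 1 / z\<^sup>2)"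
      by (intro sum_in_bigo(1) Suc.IH inverse_affine_bigo B) (use Suc.prems in simp)
    thus ?case
    proof (rule landau_o.big.in_cong[THEN iffD1, rotated],
           intro eventually_half_plane_infI[where R = "2 * \<bar>b\<bar> / B + 1"])
      fix z :: complex assume z: "norm z \<ge> 2 * \<bar>b\<bar> / B + 1"
      have "2 * \<bar>b\<bar> / B \<ge> 0" using B by simp
      hence nz: "norm z > 0" using z by linarith
      have "norm (?w z) \<ge> B * norm z / 2" by (rule norm_affine_ge) (use B z in auto)
      hence "norm (?w z) > 0" using nz B by (smt (verit) half_gt_zero mult_pos_pos)
      hence "Digamma (?w z + 1) = Digamma (?w z) + 1 / ?w z" by (intro Digamma_plus1) auto
      thus "Digamma (of_real B * z + of_real (b + 1))
            - (of_real (ln B) + Ln z + of_real (b + 1 - 1 / 2) / (of_real B * z))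
            + (1 / (of_real B * z) - 1 / ?w z) =
           Digamma (?w z) - (of_real (ln B) + Ln z + of_real (b - 1 / 2) / (of_real B * z))"
        by (simp add: add_ac diff_divide_distrib add_divide_distrib)
    qed
  qed
  moreover obtain n where "-b \<le> real n" using real_arch_simple by blast
  hence "b + real n \<ge> 0" by linarith
  ultimately show ?thesis by blast
qed

text \<open>
  A Gronwall argument along the ray through \<open>z\<close>: the hypothesis on \<open>L\<close> says that \<open>|f|\<^sup>2 * t powr (2 * \<mu>)\<close> has
  logarithmic derivative at most \<open>2 * K / t\<^sup>2\<close>, so that it becomes nonincreasing when multiplied by
  \<open>exp (2 * K / t)\<close>. Working with \<open>|f|\<^sup>2\<close> instead of \<open>ln |f|\<close> allows \<open>f\<close> to have zeros.
\<close>
lemma norm_le_radial: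
  fixes f L :: "complex \<Rightarrow> complex" and \<mu> K R :: real
  assumes R: "R > 0"
    and der: "\<And>z. Re z \<ge> 0 \<Longrightarrow> norm z \<ge> R \<Longrightarrow> (f has_field_derivative f z * L z) (at z)"
    and L: "\<And>z. Re z \<ge> 0 \<Longrightarrow> norm z \<ge> R \<Longrightarrow> norm (L z + of_real \<mu> / z) \<le> K / norm z ^ 2"
    and M: "\<And>z. Re z \<ge> 0 \<Longrightarrow> norm z = R \<Longrightarrow> norm (f z) \<le> M"
    and K: "K \<ge> 0"
    and z: "Re z \<ge> 0" "norm z \<ge> R"
  shows "norm (f z) * norm z powr \<mu> \<le> M * R powr \<mu> * exp (K / R)"
proof -
  define r u where "r = norm z" and "u = z / of_real (norm z)"
  have r: "r \<ge> R" "r > 0" using z R by (auto simp: r_def)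
  have zu: "z = of_real r * u" using r by (auto simp: r_def u_def)
  have u: "norm u = 1" "Re u \<ge> 0" using r z by (auto simp: u_def r_def norm_divide)
  define g where "g = (\<lambda>t. f (of_real t * u))"
  define \<phi> where "\<phi> = (\<lambda>t. (g t \<bullet> g t) * (t powr (2 * \<mu>) * exp (2 * K / t)))"
  have "\<phi> r \<le> \<phi> R"
  proof (rule DERIV_nonpos_imp_nonincreasing[OF r(1)])
    fix t assume t: "R \<le> t" "t \<le> r"
    have t0: "t > 0" using t R by simp
    define w where "w = of_real t * u"
    have w: "Re w \<ge> 0" "norm w = t" using u t0 by (auto simp: w_def norm_mult)
    have "(g has_vector_derivative (u * (f w * L w))) (at t)"
      unfolding g_def
      by (rule field_vector_diff_chain_at[unfolded o_def, where g = f and f = "\<lambda>t. of_real t * u"])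
         (use der[of w] w t in \<open>auto intro!: derivative_eq_intros simp: w_def has_vector_derivative_def
             scaleR_conv_of_real\<close>)
    hence "((\<lambda>t. g t \<bullet> g t) has_vector_derivative (g t \<bullet> (u * (f w * L w)) + (u * (f w * L w)) \<bullet> g t)) (at t)"
      by (intro bounded_bilinear.has_vector_derivative[OF bounded_bilinear_inner])
    also have "g t \<bullet> (u * (f w * L w)) + (u * (f w * L w)) \<bullet> g t = 2 * (g t \<bullet> g t) * Re (u * L w)"
      by (simp add: g_def w_def inner_complex_def algebra_simps)
    finally have d1: "((\<lambda>t. g t \<bullet> g t) has_real_derivative (2 * (g t \<bullet> g t) * Re (u * L w))) (at t)"
      by (simp add: has_real_derivative_iff_has_vector_derivative)
    have d2: "((\<lambda>t. t powr (2 * \<mu>) * exp (2 * K / t)) has_real_derivative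
        (2 * (\<mu> / t - K / t\<^sup>2) * (t powr (2 * \<mu>) * exp (2 * K / t)))) (at t)"
      using t0 by (auto intro!: derivative_eq_intros simp: field_simps power2_eq_square powr_diff)
    have "(\<phi> has_real_derivative 2 * \<phi> t * (Re (u * L w) + (\<mu> / t - K / t\<^sup>2))) (at t)"
      unfolding \<phi>_def by (rule DERIV_cong[OF DERIV_mult[OF d1 d2]]) (simp add: algebra_simps)
    moreover have "2 * \<phi> t * (Re (u * L w) + (\<mu> / t - K / t\<^sup>2)) \<le> 0"
    proof (rule mult_nonneg_nonpos)
      have "u * (of_real \<mu> / w) = of_real (\<mu> / t)" using u t0 by (auto simp: w_def)
      hence "Re (u * L w) + \<mu> / t = Re (u * (L w + of_real \<mu> / w))"
        by (simp add: distrib_left)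
      also have "\<dots> \<le> norm (u * (L w + of_real \<mu> / w))" by (rule complex_Re_le_cmod)
      also have "\<dots> \<le> K / t\<^sup>2" using L[of w] w t u by (simp add: norm_mult)
      finally show "Re (u * L w) + (\<mu> / t - K / t\<^sup>2) \<le> 0" by simp
    qed (use K t0 in \<open>auto simp: \<phi>_def\<close>)
    ultimately show "\<exists>y. (\<phi> has_real_derivative y) (at t) \<and> y \<le> 0" by blast
  qed
  moreover have sq: "\<phi> t = (norm (g t) * t powr \<mu> * exp (K / t))\<^sup>2" if "t > 0" for t
    by (simp add: \<phi>_def power_mult_distrib power2_norm_eq_inner powr_powr flip: exp_double powr_numeral)
       (simp add: powr_powr mult_ac powr_gt_zero)
  ultimately have "(norm (g r) * r powr \<mu> * exp (K / r))\<^sup>2 \<le> (norm (g R) * R powr \<mu> * exp (K / R))\<^sup>2"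
    using r R by simp
  hence "norm (g r) * r powr \<mu> * exp (K / r) \<le> norm (g R) * R powr \<mu> * exp (K / R)"
    by (rule power2_le_imp_le) auto
  also have "\<dots> \<le> M * R powr \<mu> * exp (K / R)"
    using M[of "of_real R * u"] u R by (intro mult_right_mono) (auto simp: g_def norm_mult)
  finally have "norm (g r) * r powr \<mu> * exp (K / r) \<le> M * R powr \<mu> * exp (K / R)" .
  moreover have "norm (g r) * r powr \<mu> * 1 \<le> norm (g r) * r powr \<mu> * exp (K / r)"
    using K r by (intro mult_left_mono) auto
  ultimately show ?thesis by (simp add: g_def r_def flip: zu[unfolded r_def])
qed

section \<open>Decay of the gamma quotient\<close>

lemma has_field_derivative_prod_logarithmic:
  fixes f D :: "'i \<Rightarrow> 'a :: real_normed_field \<Rightarrow> 'a"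
  assumes "\<And>i. i \<in> I \<Longrightarrow> (f i has_field_derivative f i z * D i z) (at z)"
  shows "((\<lambda>z. \<Prod>i\<in>I. f i z) has_field_derivative (\<Prod>i\<in>I. f i z) * (\<Sum>i\<in>I. D i z)) (at z)"
  using assms
proof (induction I rule: infinite_finite_induct)
  case (insert i I)
  have "((\<lambda>z. f i z * (\<Prod>i\<in>I. f i z)) has_field_derivative
      (f i z * D i z) * (\<Prod>i\<in>I. f i z) + (\<Prod>i\<in>I. f i z) * (\<Sum>i\<in>I. D i z) * f i z) (at z)"
    using insert by (intro DERIV_mult) auto
  also have "(f i z * D i z) * (\<Prod>i\<in>I. f i z) + (\<Prod>i\<in>I. f i z) * (\<Sum>i\<in>I. D i z) * f i z
      = (\<Prod>i\<in>insert i I. f i z) * (\<Sum>i\<in>insert i I. D i z)"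
    using insert.hyps by (simp add: algebra_simps)
  finally show ?case using insert.hyps by simp
qed auto

text \<open>
  With the entire function \<open>rGamma\<close> in place of the denominators, only the poles of the numerator matter.
\<close>
lemma gamma_quotient_conv_rGamma:
  "gamma_quotient p A a q B b s =
     (\<Prod>k=1..p. Gamma (of_real (A k) * s + of_real (a k))) *
     (\<Prod>j=1..q. rGamma (of_real (B j) * s + of_real (b j)))"
  by (simp add: gamma_quotient_def rGamma_inverse_Gamma divide_inverse flip: prod_inversef)

lemma holomorphic_on_gamma_quotient:
  assumes "\<And>z k. z \<in> S \<Longrightarrow> k \<in> {1..p} \<Longrightarrow> A k * Re z + a k > 0"
  shows "gamma_quotient p A a q B b holomorphic_on S"
proof -
  have "of_real (A k) * z + of_real (a k) \<notin> \<int>\<^sub>\<le>\<^sub>0" if "z \<in> S" "k \<in> {1..p}" for z k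
    using assms[OF that] by (auto elim!: nonpos_Ints_cases simp: complex_eq_iff)
  thus ?thesis unfolding gamma_quotient_conv_rGamma[abs_def]
    by (intro holomorphic_intros holomorphic_Gamma' holomorphic_rGamma') auto
qed

definition digamma_sum ::
  "nat \<Rightarrow> (nat \<Rightarrow> real) \<Rightarrow> (nat \<Rightarrow> real) \<Rightarrow> complex \<Rightarrow> complex" where
  "digamma_sum p A a z = (\<Sum>k=1..p. of_real (A k) * Digamma (of_real (A k) * z + of_real (a k)))"

text \<open>
  The coefficients of \<open>1\<close>, \<open>Ln z\<close> and \<open>1 / z\<close> are kept in closed form, because the cancellation between
  numerator and denominator takes place in each of them separately.
\<close>
lemma digamma_sum_bigo:
  assumes "\<And>k. k \<in> {1..p} \<Longrightarrow> A k > 0"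
  shows "(\<lambda>z. digamma_sum p A a z - (of_real (\<Sum>k=1..p. A k * ln (A k)) + of_real (\<Sum>k=1..p. A k) * Ln z
             + of_real ((\<Sum>k=1..p. a k) - real p / 2) / z))
           \<in> O[half_plane_inf](\<lambda>z. 1 / z\<^sup>2)"
proof -
  have "(\<lambda>z. \<Sum>k=1..p. of_real (A k) * (Digamma (of_real (A k) * z + of_real (a k))
           - (of_real (ln (A k)) + Ln z + of_real (a k - 1 / 2) / (of_real (A k) * z))))
           \<in> O[half_plane_inf](\<lambda>z. 1 / z\<^sup>2)"
    using assms by (intro big_sum_in_bigo landau_o.big.cmult_in_iff[THEN iffD2] Digamma_affine_bigo) force+
  also have "(\<lambda>z. \<Sum>k=1..p. of_real (A k) * (Digamma (of_real (A k) * z + of_real (a k))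
           - (of_real (ln (A k)) + Ln z + of_real (a k - 1 / 2) / (of_real (A k) * z)))) =
      (\<lambda>z. digamma_sum p A a z - (of_real (\<Sum>k=1..p. A k * ln (A k)) + of_real (\<Sum>k=1..p. A k) * Ln z
             + of_real ((\<Sum>k=1..p. a k) - real p / 2) / z))" (is "?l = ?r")
  proof
    fix z :: complex
    have "?l z = (\<Sum>k=1..p. of_real (A k) * Digamma (of_real (A k) * z + of_real (a k))
        - (of_real (A k * ln (A k)) + of_real (A k) * Ln z + of_real (a k - 1 / 2) / z))"
    proof (intro sum.cong refl)
      fix k assume "k \<in> {1..p}"
      hence "A k \<noteq> 0" using assms by force
      thus "of_real (A k) * (Digamma (of_real (A k) * z + of_real (a k))
             - (of_real (ln (A k)) + Ln z + of_real (a k - 1 / 2) / (of_real (A k) * z))) =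
          of_real (A k) * Digamma (of_real (A k) * z + of_real (a k))
             - (of_real (A k * ln (A k)) + of_real (A k) * Ln z + of_real (a k - 1 / 2) / z)"
        by (simp add: right_diff_distrib distrib_left del: of_real_diff)
    qed
    also have "\<dots> = digamma_sum p A a z - (of_real (\<Sum>k=1..p. A k * ln (A k))
        + of_real (\<Sum>k=1..p. A k) * Ln z + of_real (\<Sum>k=1..p. a k - 1 / 2) / z)"
      unfolding digamma_sum_def of_real_sum sum_distrib_right sum_divide_distrib
      by (simp only: sum_subtractf sum.distrib)
    also have "(\<Sum>k=1..p. a k - 1 / 2) = (\<Sum>k=1..p. a k) - real p / 2"
      by (simp add: sum_subtractf)
    finally show "?l z = ?r z" .
  qed
  finally show ?thesis .
qed

lemma has_field_derivative_gamma_quotient: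
  assumes "\<And>k. k \<in> {1..p} \<Longrightarrow> of_real (A k) * z + of_real (a k) \<notin> \<int>\<^sub>\<le>\<^sub>0"
    and "\<And>j. j \<in> {1..q} \<Longrightarrow> of_real (B j) * z + of_real (b j) \<notin> \<int>\<^sub>\<le>\<^sub>0"
  shows "(gamma_quotient p A a q B b has_field_derivative
            gamma_quotient p A a q B b z * (digamma_sum p A a z - digamma_sum q B b z)) (at z)"
proof -
  have "((\<lambda>z. \<Prod>k=1..p. Gamma (of_real (A k) * z + of_real (a k))) has_field_derivative
      (\<Prod>k=1..p. Gamma (of_real (A k) * z + of_real (a k))) * digamma_sum p A a z) (at z)"
    unfolding digamma_sum_def using assms(1)
    by (intro has_field_derivative_prod_logarithmic) (auto intro!: derivative_eq_intros)
  moreover have "((\<lambda>z. \<Prod>j=1..q. rGamma (of_real (B j) * z + of_real (b j))) has_field_derivative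
      (\<Prod>j=1..q. rGamma (of_real (B j) * z + of_real (b j))) * (\<Sum>j=1..q. - (of_real (B j) * Digamma (of_real (B j) * z + of_real (b j))))) (at z)"
    using assms(2)
    by (intro has_field_derivative_prod_logarithmic) (auto intro!: derivative_eq_intros)
  ultimately have "((\<lambda>z. (\<Prod>k=1..p. Gamma (of_real (A k) * z + of_real (a k))) *
     (\<Prod>j=1..q. rGamma (of_real (B j) * z + of_real (b j)))) has_field_derivative
      (\<Prod>k=1..p. Gamma (of_real (A k) * z + of_real (a k))) * digamma_sum p A a z * (\<Prod>j=1..q. rGamma (of_real (B j) * z + of_real (b j)))
      + (\<Prod>j=1..q. rGamma (of_real (B j) * z + of_real (b j))) * (\<Sum>j=1..q. - (of_real (B j) * Digamma (of_real (B j) * z + of_real (b j)))) *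
      (\<Prod>k=1..p. Gamma (of_real (A k) * z + of_real (a k)))) (at z)"
    by (rule DERIV_mult)
  thus ?thesis unfolding gamma_quotient_conv_rGamma[abs_def]
    by (rule DERIV_cong) (simp add: digamma_sum_def sum_negf algebra_simps)
qed

lemma eventually_affine_not_nonpos_Int:
  assumes "B > 0"
  shows "\<forall>\<^sub>F z in half_plane_inf. of_real B * z + of_real b \<notin> (\<int>\<^sub>\<le>\<^sub>0 :: complex set)"
proof (rule eventually_half_plane_infI[where R = "\<bar>b\<bar> / B + 1"])
  fix z :: complex assume z: "Re z \<ge> 0" "norm z \<ge> \<bar>b\<bar> / B + 1"
  show "of_real B * z + of_real b \<notin> (\<int>\<^sub>\<le>\<^sub>0 :: complex set)"
  proof
    assume "of_real B * z + of_real b \<in> (\<int>\<^sub>\<le>\<^sub>0 :: complex set)"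
    then obtain n where "of_real B * z + of_real b = of_int n" "n \<le> 0"
      by (auto elim: nonpos_Ints_cases)
    hence im: "Im z = 0" and re: "B * Re z + b \<le> 0"
      using assms by (auto simp: complex_eq_iff)
    hence "norm z = Re z" using z by (simp add: cmod_def)
    hence "B * (\<bar>b\<bar> / B + 1) \<le> B * Re z" using z assms by (intro mult_left_mono) auto
    also have "B * (\<bar>b\<bar> / B + 1) = \<bar>b\<bar> + B" using assms by (simp add: distrib_left)
    finally have "\<bar>b\<bar> + B \<le> B * Re z" .
    thus False using re assms by linarith
  qed
qed

text \<open>
  Positivity of all \<open>a k\<close> places the poles to the left of the imaginary axis, so that the
  bounds hold up to the boundary of the half-plane. Far out, the logarithmic derivative is
  \<open>- \<mu> / z + O(1 / z\<^sup>2)\<close> and \<open>norm_le_radial\<close> applies; the remaining half-disc is compact.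
\<close>
theorem gamma_quotient_decay:
  fixes A a B b :: "nat \<Rightarrow> real"
  assumes A: "\<And>k. k \<in> {1..p} \<Longrightarrow> A k > 0" and a: "\<And>k. k \<in> {1..p} \<Longrightarrow> a k > 0"
    and B: "\<And>j. j \<in> {1..q} \<Longrightarrow> B j > 0"
    and AB: "(\<Sum>k=1..p. A k) = (\<Sum>j=1..q. B j)"
    and \<mu>: "\<mu> = (\<Sum>j=1..q. b j) - (\<Sum>k=1..p. a k) + (real p - real q) / 2" "\<mu> > 0"
    and \<beta>: "\<beta> = (\<Sum>k=1..p. A k * ln (A k)) - (\<Sum>j=1..q. B j * ln (B j))"
    and F: "F = (\<lambda>z. gamma_quotient p A a q B b z * exp (- of_real \<beta> * z))"
  shows "\<exists>K\<ge>0. \<forall>z. Re z \<ge> 0 \<longrightarrow> norm (F z) \<le> K * (1 + norm z) powr (-\<mu>)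
            \<and> norm (deriv F z) \<le> K * (1 + norm z) powr (-\<mu> - 1)"
proof -
  define L where "L = (\<lambda>z. digamma_sum p A a z - digamma_sum q B b z - of_real \<beta>)"
  let ?P = "\<lambda>z. of_real (\<Sum>k=1..p. A k * ln (A k)) + of_real (\<Sum>k=1..p. A k) * Ln z
             + of_real ((\<Sum>k=1..p. a k) - real p / 2) / z"
  let ?Q = "\<lambda>z. of_real (\<Sum>j=1..q. B j * ln (B j)) + of_real (\<Sum>j=1..q. B j) * Ln z
             + of_real ((\<Sum>j=1..q. b j) - real q / 2) / z"
  have "(\<lambda>z. (digamma_sum p A a z - ?P z) - (digamma_sum q B b z - ?Q z)) \<in> O[half_plane_inf](\<lambda>z. 1 / z\<^sup>2)"
    by (rule sum_in_bigo(2)[OF digamma_sum_bigo[OF A] digamma_sum_bigo[OF B]])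
  also have "(\<lambda>z. (digamma_sum p A a z - ?P z) - (digamma_sum q B b z - ?Q z)) = (\<lambda>z. L z + of_real \<mu> / z)"
  proof
    fix z :: complex
    have "?P z - ?Q z = of_real \<beta> - of_real \<mu> / z" unfolding AB \<beta> \<mu>(1)
      by (simp add: diff_divide_distrib add_divide_distrib)
    thus "(digamma_sum p A a z - ?P z) - (digamma_sum q B b z - ?Q z) = L z + of_real \<mu> / z"
      by (simp add: L_def algebra_simps)
  qed
  finally obtain C where C: "C > 0"
    "\<forall>\<^sub>F z in half_plane_inf. norm (L z + of_real \<mu> / z) \<le> C * norm (1 / z\<^sup>2)"
    by (elim landau_o.bigE)
  have "\<forall>\<^sub>F z in half_plane_inf. (\<forall>k\<in>{1..p}. of_real (A k) * z + of_real (a k) \<notin> (\<int>\<^sub>\<le>\<^sub>0 :: complex set))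
      \<and> (\<forall>j\<in>{1..q}. of_real (B j) * z + of_real (b j) \<notin> (\<int>\<^sub>\<le>\<^sub>0 :: complex set))
      \<and> norm (L z + of_real \<mu> / z) \<le> C * norm (1 / z\<^sup>2)"
    by (intro eventually_conj eventually_ball_finite finite_atLeastAtMost ballI
          eventually_affine_not_nonpos_Int A B C(2))
  then obtain R0 where R0: "\<And>z. Re z \<ge> 0 \<Longrightarrow> norm z \<ge> R0 \<Longrightarrow>
      (\<forall>k\<in>{1..p}. of_real (A k) * z + of_real (a k) \<notin> (\<int>\<^sub>\<le>\<^sub>0 :: complex set))
      \<and> (\<forall>j\<in>{1..q}. of_real (B j) * z + of_real (b j) \<notin> (\<int>\<^sub>\<le>\<^sub>0 :: complex set))
      \<and> norm (L z + of_real \<mu> / z) \<le> C * norm (1 / z\<^sup>2)"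
    unfolding eventually_half_plane_inf by blast
  \<comment> \<open>\<open>R \<ge> 1\<close> allows \<open>1 + |z| \<le> 2 * |z|\<close> outside the half-disc.\<close>
  define R where "R = max R0 1"
  have R: "R \<ge> 1" "R \<ge> R0" by (auto simp: R_def)
  define U where "U = {z. \<forall>k\<in>{1..p}. A k * Re z + a k > 0}"
  have "U = (\<Inter>k\<in>{1..p}. {z. A k * Re z + a k > 0})" by (auto simp: U_def)
  also have "open \<dots>" by (intro open_INT ballI open_Collect_less continuous_intros) auto
  finally have U: "open U" .
  have sub: "{z. Re z \<ge> 0} \<subseteq> U"
  proof safe
    fix z :: complex assume "Re z \<ge> 0"
    thus "z \<in> U" using A a unfolding U_def
      by (intro CollectI ballI add_nonneg_pos mult_nonneg_nonneg) (simp_all add: less_imp_le)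
  qed
  have holF: "F holomorphic_on U" unfolding F
    by (intro holomorphic_intros holomorphic_on_gamma_quotient) (auto simp: U_def)
  have der: "(F has_field_derivative F z * L z) (at z)" if "Re z \<ge> 0" "norm z \<ge> R" for z
  proof -
    have "(gamma_quotient p A a q B b has_field_derivative
            gamma_quotient p A a q B b z * (digamma_sum p A a z - digamma_sum q B b z)) (at z)"
      using R0[of z] that R by (intro has_field_derivative_gamma_quotient) auto
    moreover have "((\<lambda>z. exp (- of_real \<beta> * z)) has_field_derivative
        exp (- of_real \<beta> * z) * (- of_real \<beta>)) (at z)"
      by (auto intro!: derivative_eq_intros)
    ultimately show ?thesis unfolding F L_def
      by (rule DERIV_cong[OF DERIV_mult]) (simp add: algebra_simps)
  qed
  have Lb: "norm (L z + of_real \<mu> / z) \<le> C / norm z ^ 2" if "Re z \<ge> 0" "norm z \<ge> R" for z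
    using R0[of z] that R by (simp add: norm_divide norm_power)
  define D where "D = {z. Re z \<ge> 0} \<inter> cball 0 R"
  have D: "compact D" unfolding D_def
    by (intro closed_Int_compact compact_cball closed_Collect_le continuous_intros)
  have DU: "D \<subseteq> U" using sub by (auto simp: D_def)
  have bounded_on_D: "\<exists>M\<ge>0. \<forall>z\<in>D. norm (f z) * (1 + norm z) powr e \<le> M"
    if "f holomorphic_on U" for f :: "complex \<Rightarrow> complex" and e
  proof -
    have "1 + norm z \<noteq> 0" for z :: complex by (smt (verit) norm_ge_zero)
    hence "continuous_on D (\<lambda>z. norm (f z) * (1 + norm z) powr e)"
      by (intro continuous_intros continuous_on_subset[OF holomorphic_on_imp_continuous_on[OF that] DU]) auto
    hence "bounded ((\<lambda>z. norm (f z) * (1 + norm z) powr e) ` D)"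
      using D compact_continuous_image compact_imp_bounded by blast
    then obtain M where "\<forall>z\<in>D. norm (norm (f z) * (1 + norm z) powr e) \<le> M"
      by (auto simp: bounded_iff)
    hence "\<forall>z\<in>D. norm (f z) * (1 + norm z) powr e \<le> max M 0" by fastforce
    thus ?thesis by (intro exI[of _ "max M 0"]) auto
  qed
  obtain M1 where M1: "M1 \<ge> 0" "\<And>z. z \<in> D \<Longrightarrow> norm (F z) * (1 + norm z) powr \<mu> \<le> M1"
    using bounded_on_D[OF holF] by blast
  obtain M2 where M2: "M2 \<ge> 0" "\<And>z. z \<in> D \<Longrightarrow> norm (deriv F z) * (1 + norm z) powr (\<mu> + 1) \<le> M2"
    using bounded_on_D[OF holomorphic_deriv[OF holF U]] by blast
  obtain M0 where M0: "M0 \<ge> 0" "\<And>z. z \<in> D \<Longrightarrow> norm (F z) \<le> M0"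
  proof -
    have "(1 + norm z) powr 0 = 1" for z :: complex by (smt (verit) norm_ge_zero powr_zero_eq_one)
    thus ?thesis using bounded_on_D[OF holF, of 0] that by auto
  qed
  define N where "N = M0 * R powr \<mu> * exp (C / R)"
  have N: "N \<ge> 0" using M0 by (simp add: N_def)
  have out: "norm (F z) * norm z powr \<mu> \<le> N" if "Re z \<ge> 0" "norm z \<ge> R" for z
    unfolding N_def
    by (rule norm_le_radial[OF _ der Lb]) (use R C M0 that in \<open>auto simp: D_def\<close>)
  have dbl: "(1 + norm z) powr e \<le> 2 powr e * norm z powr e" if "norm z \<ge> R" "e > 0" for z :: complex and e
    using that R by (subst powr_mult [symmetric]) (auto intro!: powr_mono2)
  have out1: "norm (F z) * (1 + norm z) powr \<mu> \<le> 2 powr \<mu> * N" if "Re z \<ge> 0" "norm z \<ge> R" for z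
  proof -
    have "norm (F z) * (1 + norm z) powr \<mu> \<le> norm (F z) * (2 powr \<mu> * norm z powr \<mu>)"
      using dbl[OF that(2) \<mu>(2)] by (intro mult_left_mono) auto
    also have "\<dots> = 2 powr \<mu> * (norm (F z) * norm z powr \<mu>)" by simp
    also have "\<dots> \<le> 2 powr \<mu> * N" using out[OF that] by (intro mult_left_mono) auto
    finally show ?thesis .
  qed
  have out2: "norm (deriv F z) * (1 + norm z) powr (\<mu> + 1) \<le> 2 powr (\<mu> + 1) * (N * (\<mu> + C))"
    if z: "Re z \<ge> 0" "norm z \<ge> R" for z
  proof -
    have z1: "norm z \<ge> 1" using z R by simp
    have "deriv F z = F z * L z" using der[OF z] by (rule DERIV_imp_deriv)
    moreover have "norm (L z) * norm z \<le> \<mu> + C"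
    proof -
      have "norm (L z) = norm (L z + of_real \<mu> / z - of_real \<mu> / z)" by simp
      also have "\<dots> \<le> norm (L z + of_real \<mu> / z) + norm (of_real \<mu> / z)" by (rule norm_triangle_ineq4)
      also have "\<dots> \<le> C / norm z ^ 2 + \<mu> / norm z" using Lb[OF z] \<mu>(2) by (simp add: norm_divide)
      also have "C / norm z ^ 2 \<le> C / norm z"
      proof (rule divide_left_mono)
        show "norm z \<le> norm z ^ 2" using z1 by (rule self_le_power) auto
        show "0 < (norm z)\<^sup>2 * norm z" using z1 by (intro mult_pos_pos zero_less_power) auto
      qed (use C in auto)
      finally have "norm (L z) \<le> (\<mu> + C) / norm z" by (simp add: add_divide_distrib)
      moreover have "norm z > 0" using z1 by linarith
      ultimately show ?thesis by (simp add: pos_le_divide_eq)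
    qed
    ultimately have "norm (deriv F z) * norm z \<le> norm (F z) * (\<mu> + C)"
      by (simp add: norm_mult mult.assoc mult_left_mono)
    hence "norm (deriv F z) * norm z * norm z powr \<mu> \<le> norm (F z) * (\<mu> + C) * norm z powr \<mu>"
      by (intro mult_right_mono) auto
    also have "\<dots> = norm (F z) * norm z powr \<mu> * (\<mu> + C)" by simp
    also have "\<dots> \<le> N * (\<mu> + C)" using out[OF z] \<mu> C by (intro mult_right_mono) auto
    finally have *: "norm (deriv F z) * norm z powr (\<mu> + 1) \<le> N * (\<mu> + C)"
      using z1 by (simp add: powr_add mult_ac)
    have "norm (deriv F z) * (1 + norm z) powr (\<mu> + 1) \<le> norm (deriv F z) * (2 powr (\<mu> + 1) * norm z powr (\<mu> + 1))"
      using dbl[OF that(2), of "\<mu> + 1"] \<mu>(2) by (intro mult_left_mono) auto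
    also have "\<dots> = 2 powr (\<mu> + 1) * (norm (deriv F z) * norm z powr (\<mu> + 1))" by simp
    also have "\<dots> \<le> 2 powr (\<mu> + 1) * (N * (\<mu> + C))" using * by (intro mult_left_mono) auto
    finally show ?thesis .
  qed
  define N1 N2 where "N1 = 2 powr \<mu> * N" and "N2 = 2 powr (\<mu> + 1) * (N * (\<mu> + C))"
  note out1 = out1[folded N1_def] and out2 = out2[folded N2_def]
  define K where "K = M1 + M2 + N1 + N2"
  have nn: "N1 \<ge> 0" "N2 \<ge> 0" unfolding N1_def N2_def using N \<mu> C by auto
  have "norm (F z) * (1 + norm z) powr \<mu> \<le> K \<and> norm (deriv F z) * (1 + norm z) powr (\<mu> + 1) \<le> K"
    if "Re z \<ge> 0" for z
  proof (cases "norm z \<ge> R")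
    case True
    have "N1 \<le> K" "N2 \<le> K" using nn M1(1) M2(1) by (auto simp: K_def)
    thus ?thesis using out1[OF that True] out2[OF that True] by (meson order_trans)
  next
    case False
    hence "z \<in> D" using that by (auto simp: D_def)
    moreover have "M1 \<le> K" "M2 \<le> K" using nn M1(1) M2(1) by (auto simp: K_def)
    ultimately show ?thesis using M1(2)[of z] M2(2)[of z] by (meson order_trans)
  qed
  note bound = this
  have conv: "x \<le> K * (1 + norm z) powr (-e)" if "x * (1 + norm z) powr e \<le> K" for x e and z :: complex
  proof -
    have "(1 + norm z) powr e > 0" by (smt (verit) norm_ge_zero powr_gt_zero)
    thus ?thesis using that by (simp add: powr_minus field_simps)
  qed
  have "\<forall>z. Re z \<ge> 0 \<longrightarrow> norm (F z) \<le> K * (1 + norm z) powr (-\<mu>)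
            \<and> norm (deriv F z) \<le> K * (1 + norm z) powr (-(\<mu> + 1))"
    using bound by (intro allI impI conjI conv) auto
  hence "\<forall>z. Re z \<ge> 0 \<longrightarrow> norm (F z) \<le> K * (1 + norm z) powr (-\<mu>)
            \<and> norm (deriv F z) \<le> K * (1 + norm z) powr (-\<mu> - 1)" by simp
  moreover have "K \<ge> 0" unfolding K_def using nn M1 M2 by simp
  ultimately show ?thesis by blast
qed

section \<open>Integrals along vertical lines\<close>

definition vertical_integral :: "(complex \<Rightarrow> complex) \<Rightarrow> real \<Rightarrow> complex" where
  "vertical_integral f c = (LINT t|lborel. f (Complex c t))"

lemma contour_integral_tendsto_vertical_integral:
  assumes int: "integrable lborel (\<lambda>t. f (Complex c t))"
  shows "((\<lambda>R. contour_integral (linepath (Complex c (-R)) (Complex c R)) f) \<longlongrightarrow> \<i> * vertical_integral f c) at_top"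
proof -
  have "((\<lambda>R. LINT t|lborel. indicator {-R..R} t *\<^sub>R f (Complex c t)) \<longlongrightarrow> (LINT t|lborel. f (Complex c t))) at_top"
  proof (rule integral_dominated_convergence_at_top)
    show "integrable lborel (\<lambda>t. norm (f (Complex c t)))" using int by simp
    show "(\<lambda>t. f (Complex c t)) \<in> borel_measurable lborel" using int by simp
    show "(\<lambda>t. indicator {-R..R} t *\<^sub>R f (Complex c t)) \<in> borel_measurable lborel" for R :: real
      using int by simp
    show "\<forall>\<^sub>F R::real in at_top. AE t in lborel. norm (indicator {-R..R} t *\<^sub>R f (Complex c t)) \<le> norm (f (Complex c t))"
      by (auto simp: indicator_def)
    show "AE t in lborel. ((\<lambda>R. indicator {-R..R} t *\<^sub>R f (Complex c t)) \<longlongrightarrow> f (Complex c t)) at_top"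
    proof (rule AE_I2)
      fix t :: real
      show "((\<lambda>R. indicator {-R..R} t *\<^sub>R f (Complex c t)) \<longlongrightarrow> f (Complex c t)) at_top"
        by (rule tendsto_eventually, rule eventually_mono[OF eventually_ge_at_top[of "\<bar>t\<bar>"]])
             (auto simp: indicator_def abs_le_iff)
    qed
  qed
  hence "((\<lambda>R. \<i> * (LINT t:{-R..R}|lborel. f (Complex c t))) \<longlongrightarrow> \<i> * vertical_integral f c) at_top"
    by (intro tendsto_intros) (simp add: vertical_integral_def set_lebesgue_integral_def)
  moreover have "\<forall>\<^sub>F R in at_top. \<i> * (LINT t:{-R..R}|lborel. f (Complex c t)) =
      contour_integral (linepath (Complex c (-R)) (Complex c R)) f"
    using eventually_gt_at_top[of 0]
  proof eventually_elim
    case (elim R)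
    have "set_integrable lborel {-R..R} (\<lambda>t. f (Complex c t))"
      using set_integrable_subset[of lborel UNIV "\<lambda>t. f (Complex c t)" "{-R..R}"] int
      by (simp add: set_integrable_def)
    from set_borel_integral_eq_integral(2)[OF this]
    show ?case using elim by (subst contour_integral_linepath_same_Re[where c = c and a = "-R" and b = R]) auto
  qed
  ultimately show ?thesis by (rule Lim_transform_eventually)
qed

text \<open>
  The Cauchy integral formula for the rectangle with vertical sides on the abscissae \<open>c\<close> and \<open>c'\<close>, whose
  horizontal sides contribute at most \<open>2 * \<beta> R * (c' - c)\<close>. Taking \<open>g w = f w * (w - s)\<close> with \<open>f\<close> holomorphic
  also covers the case without a pole.
\<close>
lemma vertical_integral_difference:
  fixes f g :: "complex \<Rightarrow> complex"
  assumes g: "g holomorphic_on {z. Re z > \<gamma>}"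
    and s: "\<gamma> < c" "c < Re s" "Re s < c'"
    and f: "\<And>w. w \<noteq> s \<Longrightarrow> f w = g w / (w - s)"
    and int: "integrable lborel (\<lambda>t. f (Complex c t))" "integrable lborel (\<lambda>t. f (Complex c' t))"
    and \<beta>: "(\<beta> \<longlongrightarrow> 0) at_top"
    and bound: "\<And>x R. c \<le> x \<Longrightarrow> x \<le> c' \<Longrightarrow> R \<ge> R0 \<Longrightarrow>
                   norm (f (Complex x R)) \<le> \<beta> R \<and> norm (f (Complex x (-R))) \<le> \<beta> R"
  shows "vertical_integral f c' - vertical_integral f c = 2 * pi * g s"
proof -
  let ?S = "{z. Re z > \<gamma>}"
  let ?I = "\<lambda>c R. contour_integral (linepath (Complex c (-R)) (Complex c R)) f"
  have S: "convex ?S" "open ?S" by (auto simp: convex_halfspace_Re_gt open_halfspace_Re_gt)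
  have lim: "((\<lambda>R. ?I c' R - ?I c R - 2 * pi * \<i> * g s) \<longlongrightarrow>
      \<i> * vertical_integral f c' - \<i> * vertical_integral f c - 2 * pi * \<i> * g s) at_top"
    by (intro tendsto_intros contour_integral_tendsto_vertical_integral int)
  have "((\<lambda>R. ?I c' R - ?I c R - 2 * pi * \<i> * g s) \<longlongrightarrow> 0) at_top"
  proof (rule Lim_null_comparison)
    show "((\<lambda>R. 2 * (\<beta> R * (c' - c))) \<longlongrightarrow> 0) at_top"
      by (intro tendsto_mult_right_zero tendsto_mult_left_zero \<beta>)
    show "\<forall>\<^sub>F R in at_top. norm (?I c' R - ?I c R - 2 * pi * \<i> * g s) \<le> 2 * (\<beta> R * (c' - c))"
      using eventually_gt_at_top[of "\<bar>Im s\<bar>"] eventually_ge_at_top[of R0]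
    proof eventually_elim
      case (elim R)
      define a1 a2 a3 a4 where "a1 = Complex c (-R)" and "a2 = Complex c' (-R)"
        and "a3 = Complex c' R" and "a4 = Complex c R"
      have R: "R > 0" using elim by linarith
      have contf: "continuous_on (?S - {s}) f"
        by (subst continuous_on_cong[OF refl f])
           (auto intro!: continuous_intros continuous_on_subset[OF holomorphic_on_imp_continuous_on[OF g]])
      have seg: "closed_segment a1 a2 \<subseteq> ?S - {s}" "closed_segment a2 a3 \<subseteq> ?S - {s}"
           "closed_segment a3 a4 \<subseteq> ?S - {s}" "closed_segment a4 a1 \<subseteq> ?S - {s}"
        using s elim R
        by (auto simp: a1_def a2_def a3_def a4_def closed_segment_same_Re closed_segment_same_Im
              closed_segment_eq_real_ivl split: if_splits)
      have ci: "f contour_integrable_on linepath a1 a2" "f contour_integrable_on linepath a2 a3"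
           "f contour_integrable_on linepath a3 a4" "f contour_integrable_on linepath a4 a1"
        by (auto intro!: contour_integrable_continuous_linepath continuous_on_subset[OF contf] seg)
      have rp: "rectpath a1 a3 = linepath a1 a2 +++ linepath a2 a3 +++ linepath a3 a4 +++ linepath a4 a1"
        by (simp add: rectpath_def Let_def a1_def a2_def a3_def a4_def)
      have img: "path_image (rectpath a1 a3) \<subseteq> ?S - {s}"
        using seg by (auto simp: rp path_image_join)
      have "s \<in> box a1 a3" using s elim by (auto simp: in_box_complex_iff a1_def a3_def)
      hence w: "winding_number (rectpath a1 a3) s = 1" by (rule winding_number_rectpath)
      have "((\<lambda>w. g w / (w - s)) has_contour_integral (2 * pi * \<i> * 1 * g s)) (rectpath a1 a3)"
        unfolding w [symmetric]
        using S img s g by (intro Cauchy_integral_formula_convex_simple[where S = ?S]) (auto simp: interior_open)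
      hence "(f has_contour_integral (2 * pi * \<i> * g s)) (rectpath a1 a3)"
        using img by (subst has_contour_integral_cong[of _ f "\<lambda>w. g w / (w - s)"]) (auto intro!: f)
      hence "2 * pi * \<i> * g s = contour_integral (rectpath a1 a3) f"
        by (simp add: contour_integral_unique)
      also have "\<dots> = contour_integral (linepath a1 a2) f + (contour_integral (linepath a2 a3) f
          + (contour_integral (linepath a3 a4) f + contour_integral (linepath a4 a1) f))"
        unfolding rp using ci by (subst contour_integral_join; simp)+
      also have "contour_integral (linepath a4 a1) f = - contour_integral (linepath a1 a4) f"
        by (intro contour_integral_reverse_linepath continuous_on_subset[OF contf] seg)
      finally have eq: "contour_integral (linepath a2 a3) f - contour_integral (linepath a1 a4) f - 2 * pi * \<i> * g s
          = - (contour_integral (linepath a1 a2) f + contour_integral (linepath a3 a4) f)"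
        by (simp add: algebra_simps)
      have \<beta>0: "\<beta> R \<ge> 0" using bound[of c R] s elim by (smt (verit) norm_ge_zero)
      have "norm (contour_integral (linepath a1 a2) f) \<le> \<beta> R * norm (a2 - a1)"
      proof (intro contour_integral_bound_linepath ci \<beta>0)
        fix z assume "z \<in> closed_segment a1 a2"
        hence "z = Complex (Re z) (-R)" "c \<le> Re z" "Re z \<le> c'" using s
          by (auto simp: a1_def a2_def closed_segment_same_Im closed_segment_eq_real_ivl complex_eq_iff)
        thus "norm (f z) \<le> \<beta> R" using bound[of "Re z" R] elim by simp
      qed
      moreover have "norm (contour_integral (linepath a3 a4) f) \<le> \<beta> R * norm (a4 - a3)"
      proof (intro contour_integral_bound_linepath ci \<beta>0)
        fix z assume "z \<in> closed_segment a3 a4"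
        hence "z = Complex (Re z) R" "c \<le> Re z" "Re z \<le> c'" using s
          by (auto simp: a3_def a4_def closed_segment_same_Im closed_segment_eq_real_ivl complex_eq_iff)
        thus "norm (f z) \<le> \<beta> R" using bound[of "Re z" R] elim by simp
      qed
      moreover have "norm (a2 - a1) = c' - c" "norm (a4 - a3) = c' - c"
        using s by (auto simp: a1_def a2_def a3_def a4_def cmod_def)
      ultimately have "norm (contour_integral (linepath a1 a2) f + contour_integral (linepath a3 a4) f)
          \<le> 2 * (\<beta> R * (c' - c))"
        by (intro order_trans[OF norm_triangle_ineq]) simp
      thus ?case using eq unfolding a1_def a2_def a3_def a4_def by (simp only: norm_minus_cancel)
    qed
  qed
  from tendsto_unique[OF _ lim this]
  have "\<i> * (vertical_integral f c' - vertical_integral f c) = \<i> * (2 * pi * g s)"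
    by (simp add: algebra_simps)
  thus ?thesis by (simp only: mult_cancel_left) simp
qed

lemma set_integrable_powr_at_top:
  assumes "e > 1"
  shows "set_integrable lborel {1..} (\<lambda>t::real. t powr (-e))"
proof -
  have "((\<lambda>t::real. t powr (-e)) has_integral -(1 powr (-e + 1)) / (-e + 1)) {1..}"
    using assms by (intro has_integral_powr_to_inf) auto
  hence "(\<lambda>t::real. t powr (-e)) absolutely_integrable_on {1..}"
    by (intro nonnegative_absolutely_integrable_1) (auto simp: integrable_on_def)
  thus ?thesis unfolding set_integrable_def
    by (subst (asm) integrable_completion) auto
qed

text \<open>
  The scaling \<open>t \<mapsto> x * t\<close> gives the dependence on the abscissa. The power of \<open>x\<close> is what makes
  integrals over \<open>F'\<close> small on lines far to the right.
\<close>
lemma integrable_norm_Complex_powr: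
  assumes e: "e > 1" and x: "x > 0"
  shows "integrable lborel (\<lambda>t. norm (Complex x t) powr (-e))"
    and "(LINT t|lborel. norm (Complex x t) powr (-e)) =
            x powr (1 - e) * (LINT t|lborel. norm (Complex 1 t) powr (-e))"
proof -
  let ?k = "\<lambda>t. norm (Complex 1 t) powr (-e)"
  have ge1: "norm (Complex 1 t) \<ge> 1" for t using complex_Re_le_cmod[of "Complex 1 t"] by simp
  have get: "norm (Complex 1 t) \<ge> \<bar>t\<bar>" for t using abs_Im_le_cmod[of "Complex 1 t"] by simp
  have I1: "integrable lborel (\<lambda>t. indicator {1..} t *\<^sub>R (t powr (-e)))"
    using set_integrable_powr_at_top[OF e] by (simp add: set_integrable_def)
  have I2: "integrable lborel (\<lambda>t. indicator {1..} (0 + (-1) * t) *\<^sub>R ((0 + (-1) * t) powr (-e)))"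
    by (rule lborel_integrable_real_affine[OF I1]) simp
  have I3: "integrable lborel (indicator {-1..1 :: real} :: real \<Rightarrow> real)"
    by (rule integrable_real_indicator) auto
  have meas [measurable]: "?k \<in> borel_measurable lborel"
    unfolding complex_norm by (auto simp: measurable_lborel1)
  have k: "integrable lborel ?k"
  proof (rule Bochner_Integration.integrable_bound[OF Bochner_Integration.integrable_add[OF Bochner_Integration.integrable_add[OF I1 I2] I3]])
    show "AE t in lborel. norm (?k t) \<le> norm (indicator {1..} t *\<^sub>R (t powr (-e)) +
       indicator {1..} (0 + (-1) * t) *\<^sub>R ((0 + (-1) * t) powr (-e)) + (indicator {-1..1} t :: real))"
    proof (rule AE_I2)
      fix t :: real
      have a: "?k t \<le> 1" using ge1[of t] e powr_mono[of "-e" 0 "norm (Complex 1 t)"] by (auto split: if_splits)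
      have b: "?k t \<le> \<bar>t\<bar> powr (-e)" if "\<bar>t\<bar> \<ge> 1" using get[of t] e that by (intro powr_mono2') auto
      \<comment> \<open>\<open>|Complex 1 t|\<close> is at least \<open>max 1 |t|\<close>; the three summands of the majorant cover the three ranges of \<open>t\<close>.\<close>
      consider "t \<ge> 1" | "t \<le> -1" | "-1 < t" "t < 1" by linarith
      thus "norm (?k t) \<le> norm (indicator {1..} t *\<^sub>R (t powr (-e)) +
         indicator {1..} (0 + (-1) * t) *\<^sub>R ((0 + (-1) * t) powr (-e)) + (indicator {-1..1} t :: real))"
        by cases (use a b in \<open>auto simp: indicator_def\<close>)
    qed
  qed auto
  have scale: "norm (Complex x t) powr (-e) = x powr (-e) * ?k (0 + (1 / x) * t)" for t
  proof -
    have "Complex x t = of_real x * Complex 1 (t / x)" using x by (simp add: complex_eq_iff)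
    hence "norm (Complex x t) = x * norm (Complex 1 (t / x))" using x by (simp only: norm_mult) simp
    thus ?thesis using x by (simp add: powr_mult)
  qed
  show "integrable lborel (\<lambda>t. norm (Complex x t) powr (-e))"
    unfolding scale using x by (intro integrable_mult_right lborel_integrable_real_affine k) auto
  have "(LINT t|lborel. ?k t) = \<bar>1 / x\<bar> *\<^sub>R (LINT t|lborel. ?k (0 + (1 / x) * t))"
    using x by (intro lborel_integral_real_affine) auto
  hence "(LINT t|lborel. ?k (0 + (1 / x) * t)) = x * (LINT t|lborel. ?k t)"
    using x by (simp add: field_simps)
  thus "(LINT t|lborel. norm (Complex x t) powr (-e)) = x powr (1 - e) * (LINT t|lborel. ?k t)"
    unfolding scale integral_mult_right_zero using x by (simp add: powr_diff powr_minus divide_inverse)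
qed

section \<open>Laplace inversion for functions decaying in a half-plane\<close>

text \<open>
  The case \<open>Im z \<noteq> 0\<close> is needed as the inner integral of a Fubini argument on a vertical line.
\<close>
lemma integrable_exp_minus:
  fixes z :: complex
  assumes z: "Re z > 0"
  shows "set_integrable lborel {0<..} (\<lambda>t. exp (- of_real t * z))"
    and "(LINT t:{0<..}|lborel. exp (- of_real t * z)) = 1 / z"
proof -
  let ?e = "\<lambda>t::real. exp (- of_real t * z)"
  have z0: "z \<noteq> 0" using z by auto
  have "((\<lambda>t. exp (- Re z * t)) has_integral exp (- Re z * 0) / Re z) {0..}"
    by (rule has_integral_exp_minus_to_infinity[OF z])
  hence "(\<lambda>t. exp (- Re z * t)) absolutely_integrable_on {0..}"
    by (intro nonnegative_absolutely_integrable_1) (auto simp: integrable_on_def)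
  hence "integrable lborel (\<lambda>t. indicator {0..} t *\<^sub>R exp (- Re z * t))"
    unfolding set_integrable_def by (subst (asm) integrable_completion) auto
  hence int: "set_integrable lborel {0..} ?e"
    unfolding set_integrable_def
    by (rule Bochner_Integration.integrable_bound) (auto simp: indicator_def mult.commute)
  show int': "set_integrable lborel {0<..} ?e"
    by (rule set_integrable_subset[OF int]) auto
  have "((\<lambda>b. LINT t:{0..b}|lborel. ?e t) \<longlongrightarrow> (LINT t:{0..}|lborel. ?e t)) at_top"
    by (rule tendsto_set_lebesgue_integral_at_top[OF _ int]) auto
  moreover have "\<forall>\<^sub>F b in at_top. (LINT t:{0..b}|lborel. ?e t) = (1 - ?e b) / z"
    using eventually_ge_at_top[of 0]
  proof eventually_elim
    case (elim b)
    have "(?e has_integral (- ?e b / z - (- ?e 0 / z))) {0..b}"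
    proof (rule fundamental_theorem_of_calculus[OF elim])
      fix t :: real
      have "((\<lambda>w. - exp (- w * z) / z) has_field_derivative exp (- of_real t * z)) (at (of_real t))"
        using z0 by (auto intro!: derivative_eq_intros)
      from has_vector_derivative_real_field[OF this]
      show "((\<lambda>t. - ?e t / z) has_vector_derivative ?e t) (at t within {0..b})"
        by simp
    qed
    hence "integral {0..b} ?e = (1 - ?e b) / z"
      by (simp add: integral_unique diff_divide_distrib)
    moreover have "set_integrable lborel {0..b} ?e"
      by (rule set_integrable_subset[OF int]) auto
    ultimately show ?case by (simp add: set_borel_integral_eq_integral)
  qed
  ultimately have "((\<lambda>b. (1 - ?e b) / z) \<longlongrightarrow> (LINT t:{0..}|lborel. ?e t)) at_top"
    by (rule Lim_transform_eventually)
  moreover have "((\<lambda>b. (1 - ?e b) / z) \<longlongrightarrow> (1 - 0) / z) at_top"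
  proof (intro tendsto_intros z0)
    have "((\<lambda>b. exp (- (Re z * b))) \<longlongrightarrow> 0) at_top"
      by (intro filterlim_compose[OF exp_at_bot] filterlim_compose[OF filterlim_uminus_at_bot_at_top]
           filterlim_tendsto_pos_mult_at_top[OF tendsto_const z] filterlim_ident)
    thus "(?e \<longlongrightarrow> 0) at_top"
      by (subst tendsto_norm_zero_iff[symmetric]) (simp add: mult.commute)
  qed
  ultimately have "(LINT t:{0..}|lborel. ?e t) = (1 - 0) / z"
    by (rule tendsto_unique[OF trivial_limit_at_top_linorder])
  moreover have "(LINT t:{0<..}|lborel. ?e t) = (LINT t:{0..}|lborel. ?e t)"
    unfolding set_lebesgue_integral_def
  proof (rule integral_cong_AE)
    show "AE t in lborel. indicator {0<..} t *\<^sub>R ?e t = indicator {0..} t *\<^sub>R ?e t"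
      using AE_lborel_singleton[of "0::real"] by eventually_elim (auto simp: indicator_def)
  qed auto
  ultimately show "(LINT t:{0<..}|lborel. ?e t) = 1 / z" by simp
qed

lemma set_integrable_powr_times_exp:
  fixes \<mu> \<delta> :: real
  assumes "\<mu> > 0" "\<delta> > 0"
  shows "set_integrable lborel {0<..} (\<lambda>t. t powr (\<mu> - 1) * exp (- \<delta> * t))"
proof -
  have "(\<lambda>t. complex_of_real t powr (of_real \<mu> - 1) / of_real (exp (\<delta> * t))) absolutely_integrable_on {0<..}"
    using assms by (intro absolutely_integrable_Gamma_integral) auto
  hence "(\<lambda>t. norm (complex_of_real t powr (of_real \<mu> - 1) / of_real (exp (\<delta> * t)))) absolutely_integrable_on {0<..}"
    by (rule absolutely_integrable_norm[unfolded o_def])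
  also have "?this \<longleftrightarrow> (\<lambda>t. t powr (\<mu> - 1) * exp (- \<delta> * t)) absolutely_integrable_on {0<..}"
    by (intro set_integrable_cong) (auto simp: norm_divide norm_powr_real_powr exp_minus field_simps)
  finally show ?thesis unfolding set_integrable_def
    by (subst (asm) integrable_completion) auto
qed

text \<open>
  The properties of \<open>F z = gamma_quotient p A a q B b z * \<rho> powr (- z)\<close> that the inversion needs. The constant
  \<open>K\<close> depends on \<open>c\<close> but is uniform in the half-plane \<open>Re z \<ge> c\<close>.
\<close>
locale half_plane_decay =
  fixes F :: "complex \<Rightarrow> complex" and \<gamma> \<mu> :: real
  assumes mu_pos: "\<mu> > 0"
    and holomorphic: "F holomorphic_on {z. Re z > \<gamma>}"
    and decay: "c > \<gamma> \<Longrightarrow> \<exists>K\<ge>0. \<forall>z. Re z \<ge> c \<longrightarrow>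
                  norm (F z) \<le> K * (1 + norm (z - of_real c)) powr (-\<mu>) \<and>
                  norm (deriv F z) \<le> K * (1 + norm (z - of_real c)) powr (-\<mu> - 1)"
begin

lemma deriv_holomorphic: "deriv F holomorphic_on {z. Re z > \<gamma>}"
  by (intro holomorphic_deriv holomorphic open_halfspace_Re_gt)

lemma continuous_on_vertical:
  assumes "c > \<gamma>" "f holomorphic_on {z. Re z > \<gamma>}"
  shows "continuous_on UNIV (\<lambda>t. f (Complex c t))"
proof -
  have "continuous_on UNIV (\<lambda>t. Complex c t)"
    unfolding Complex_eq by (intro continuous_intros)
  thus ?thesis
    by (rule continuous_on_compose2[OF holomorphic_on_imp_continuous_on[OF assms(2)]]) (use assms in auto)
qed

lemma measurable_vertical [measurable]:
  assumes "c > \<gamma>"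
  shows "(\<lambda>t. deriv F (Complex c t)) \<in> borel_measurable borel"
  by (intro borel_measurable_continuous_onI continuous_on_vertical assms deriv_holomorphic)

lemma deriv_decay_vertical:
  assumes "c > \<gamma>"
  obtains K where "K \<ge> 0"
    "\<And>v t. v \<ge> 0 \<Longrightarrow> norm (deriv F (Complex (c + v) t)) \<le> K * norm (Complex (1 + v) t) powr (-\<mu> - 1)"
proof -
  obtain K where K: "K \<ge> 0" "\<And>z. Re z \<ge> c \<Longrightarrow>
      norm (deriv F z) \<le> K * (1 + norm (z - of_real c)) powr (-\<mu> - 1)"
    using decay[OF assms] by blast
  show ?thesis
  proof (rule that[OF K(1)])
    fix v t :: real assume v: "v \<ge> 0"
    have "norm (Complex (1 + v) t) = norm (1 + Complex v t)" by (rule arg_cong[of _ _ norm]) (simp add: complex_eq_iff)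
    also have "\<dots> \<le> 1 + norm (Complex v t)" using norm_triangle_ineq[of 1 "Complex v t"] by simp
    finally have le: "norm (Complex (1 + v) t) \<le> 1 + norm (Complex v t)" .
    have "norm (Complex (1 + v) t) > 0" using v by (simp add: complex_eq_iff)
    hence "(1 + norm (Complex v t)) powr (-\<mu> - 1) \<le> norm (Complex (1 + v) t) powr (-\<mu> - 1)"
      using le mu_pos by (intro powr_mono2') auto
    hence "K * (1 + norm (Complex v t)) powr (-\<mu> - 1) \<le> K * norm (Complex (1 + v) t) powr (-\<mu> - 1)"
      using K(1) by (rule mult_left_mono)
    moreover have "Complex (c + v) t - of_real c = Complex v t" by (simp add: complex_eq_iff)
    ultimately show "norm (deriv F (Complex (c + v) t)) \<le> K * norm (Complex (1 + v) t) powr (-\<mu> - 1)"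
      using K(2)[of "Complex (c + v) t"] v by simp
  qed
qed

lemma decay_horizontal:
  assumes "c > \<gamma>"
  shows "\<exists>K\<ge>0. \<forall>z. Re z \<ge> c \<and> Im z \<noteq> 0 \<longrightarrow>
           norm (F z) \<le> K * \<bar>Im z\<bar> powr (-\<mu>) \<and> norm (deriv F z) \<le> K * \<bar>Im z\<bar> powr (-\<mu> - 1)"
proof -
  obtain K where K: "K \<ge> 0" "\<And>z. Re z \<ge> c \<Longrightarrow>
      norm (F z) \<le> K * (1 + norm (z - of_real c)) powr (-\<mu>) \<and>
      norm (deriv F z) \<le> K * (1 + norm (z - of_real c)) powr (-\<mu> - 1)"
    using decay[OF assms] by blast
  have "\<bar>Im z\<bar> \<le> 1 + norm (z - of_real c)" for z
    using abs_Im_le_cmod[of "z - of_real c"] by simp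
  hence le: "K * (1 + norm (z - of_real c)) powr (-e) \<le> K * \<bar>Im z\<bar> powr (-e)" if "e > 0" "Im z \<noteq> 0" for z e
    using that K(1) by (intro mult_left_mono powr_mono2') auto
  show ?thesis
  proof (intro exI[of _ K] allI impI conjI K(1))
    fix z assume z: "Re z \<ge> c \<and> Im z \<noteq> 0"
    show "norm (F z) \<le> K * \<bar>Im z\<bar> powr (-\<mu>)"
      using K(2)[of z] le[OF mu_pos, of z] z by linarith
    have "K * (1 + norm (z - of_real c)) powr (-\<mu> - 1) \<le> K * \<bar>Im z\<bar> powr (-\<mu> - 1)"
      using le[of "\<mu> + 1" z] mu_pos z by simp
    thus "norm (deriv F z) \<le> K * \<bar>Im z\<bar> powr (-\<mu> - 1)"
      using K(2)[of z] z by linarith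
  qed
qed

lemma integrable_deriv_vertical:
  assumes "c > \<gamma>"
  shows "integrable lborel (\<lambda>t. deriv F (Complex c t))"
proof -
  obtain K where K: "K \<ge> 0"
    "\<And>v t. v \<ge> 0 \<Longrightarrow> norm (deriv F (Complex (c + v) t)) \<le> K * norm (Complex (1 + v) t) powr (-\<mu> - 1)"
    using deriv_decay_vertical[OF assms] by blast
  have "integrable lborel (\<lambda>t. K * norm (Complex 1 t) powr (-(\<mu> + 1)))"
    using mu_pos by (intro integrable_mult_right integrable_norm_Complex_powr(1)) auto
  thus ?thesis
  proof (rule Bochner_Integration.integrable_bound)
    show "(\<lambda>t. deriv F (Complex c t)) \<in> borel_measurable lborel"
      using measurable_vertical[OF assms] by simp
  qed (use K(2)[of 0] K(1) in auto)
qed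

text \<open>
  The inversion integral of \<open>F'\<close>, without the factor \<open>1 / (2 * \<pi>)\<close>. It converges absolutely.
\<close>
definition deriv_inversion :: "real \<Rightarrow> real \<Rightarrow> complex" where
  "deriv_inversion c \<tau> = vertical_integral (\<lambda>z. deriv F z * exp (of_real \<tau> * z)) c"

lemma integrable_deriv_inversion:
  assumes "c > \<gamma>"
  shows "integrable lborel (\<lambda>t. deriv F (Complex c t) * exp (of_real \<tau> * Complex c t))"
proof (rule Bochner_Integration.integrable_bound)
  show "integrable lborel (\<lambda>t. exp (\<tau> * c) *\<^sub>R deriv F (Complex c t))"
    by (intro integrable_scaleR_right integrable_deriv_vertical assms)
  have "(\<lambda>t. Complex c t) \<in> borel_measurable borel"
    unfolding Complex_eq by measurable
  thus "(\<lambda>t. deriv F (Complex c t) * exp (of_real \<tau> * Complex c t)) \<in> borel_measurable lborel"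
    using measurable_vertical[OF assms] by simp
qed (simp add: norm_mult)

text \<open>
  The constant is the same for all abscissae \<open>c + v\<close> with \<open>v \<ge> 0\<close>, which leaves \<open>v\<close> free to be chosen in
  terms of \<open>\<tau>\<close>.
\<close>
lemma norm_deriv_inversion_le:
  assumes "c > \<gamma>"
  obtains M where "M \<ge> 0" "\<And>v \<tau>. v \<ge> 0 \<Longrightarrow>
    norm (deriv_inversion (c + v) \<tau>) \<le> M * exp (\<tau> * (c + v)) * (1 + v) powr (-\<mu>)"
proof -
  obtain K where K: "K \<ge> 0"
    "\<And>v t. v \<ge> 0 \<Longrightarrow> norm (deriv F (Complex (c + v) t)) \<le> K * norm (Complex (1 + v) t) powr (-\<mu> - 1)"
    using deriv_decay_vertical[OF assms] by blast
  define W where "W = (LINT t|lborel. norm (Complex 1 t) powr (-(\<mu> + 1)))"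
  show ?thesis
  proof (rule that[of "K * W"])
    show "K * W \<ge> 0" unfolding W_def by (intro mult_nonneg_nonneg K Bochner_Integration.integral_nonneg) auto
    fix v \<tau> :: real assume v: "v \<ge> 0"
    have "norm (deriv_inversion (c + v) \<tau>) \<le>
        (LINT t|lborel. norm (deriv F (Complex (c + v) t) * exp (of_real \<tau> * Complex (c + v) t)))"
      unfolding deriv_inversion_def vertical_integral_def by (rule integral_norm_bound)
    also have "\<dots> \<le> (LINT t|lborel. (K * exp (\<tau> * (c + v))) * norm (Complex (1 + v) t) powr (-(\<mu> + 1)))"
    proof (rule integral_mono)
      show "integrable lborel (\<lambda>t. norm (deriv F (Complex (c + v) t) * exp (of_real \<tau> * Complex (c + v) t)))"
        using assms v by (intro integrable_norm integrable_deriv_inversion) auto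
      show "integrable lborel (\<lambda>t. (K * exp (\<tau> * (c + v))) * norm (Complex (1 + v) t) powr (-(\<mu> + 1)))"
        using v mu_pos by (intro integrable_mult_right integrable_norm_Complex_powr(1)) auto
      show "norm (deriv F (Complex (c + v) t) * exp (of_real \<tau> * Complex (c + v) t))
          \<le> (K * exp (\<tau> * (c + v))) * norm (Complex (1 + v) t) powr (-(\<mu> + 1))" for t
        using mult_right_mono[OF K(2)[OF v, of t], of "exp (\<tau> * (c + v))"]
        by (simp add: norm_mult mult_ac)
    qed
    also have "\<dots> = (K * exp (\<tau> * (c + v))) * ((1 + v) powr (1 - (\<mu> + 1)) * W)"
      unfolding integral_mult_right_zero W_def using mu_pos v
      by (subst integrable_norm_Complex_powr(2)) auto
    finally show "norm (deriv_inversion (c + v) \<tau>) \<le> K * W * exp (\<tau> * (c + v)) * (1 + v) powr (-\<mu>)"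
      by (simp add: mult_ac)
  qed
qed

lemma deriv_inversion_abscissa:
  assumes "c > \<gamma>" "c' > \<gamma>"
  shows "deriv_inversion c \<tau> = deriv_inversion c' \<tau>"
proof -
  have less: "deriv_inversion c \<tau> = deriv_inversion c' \<tau>" if c: "c > \<gamma>" "c < c'" for c c'
  proof -
    \<comment> \<open>Any point strictly between the two lines will do: the factor \<open>z - s\<close> cancels the pole.\<close>
    define s where "s = Complex ((c + c') / 2) 0"
    define f where "f = (\<lambda>z. deriv F z * exp (of_real \<tau> * z))"
    obtain K where K: "K \<ge> 0"
      "\<And>z. Re z \<ge> c \<Longrightarrow> Im z \<noteq> 0 \<Longrightarrow> norm (F z) \<le> K * \<bar>Im z\<bar> powr (-\<mu>)"
      "\<And>z. Re z \<ge> c \<Longrightarrow> Im z \<noteq> 0 \<Longrightarrow> norm (deriv F z) \<le> K * \<bar>Im z\<bar> powr (-\<mu> - 1)"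
      using decay_horizontal[OF c(1)] by blast
    define E where "E = exp (\<bar>\<tau>\<bar> * max \<bar>c\<bar> \<bar>c'\<bar>)"
    have "vertical_integral f c' - vertical_integral f c = 2 * pi * (f s * (s - s))"
    proof (rule vertical_integral_difference[where \<gamma> = \<gamma> and g = "\<lambda>z. f z * (z - s)"
          and \<beta> = "\<lambda>R. K * R powr (-\<mu> - 1) * E" and ?R0.0 = 1])
      show "(\<lambda>z. f z * (z - s)) holomorphic_on {z. Re z > \<gamma>}"
        unfolding f_def by (intro holomorphic_intros deriv_holomorphic)
      show "\<gamma> < c" "c < Re s" "Re s < c'" using c by (auto simp: s_def)
      show "integrable lborel (\<lambda>t. f (Complex c t))" "integrable lborel (\<lambda>t. f (Complex c' t))"
        unfolding f_def using c by (auto intro!: integrable_deriv_inversion)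
      show "((\<lambda>R. K * R powr (-\<mu> - 1) * E) \<longlongrightarrow> 0) at_top"
        by (intro tendsto_mult_left_zero tendsto_mult_right_zero tendsto_neg_powr filterlim_ident)
           (use mu_pos in simp)
      fix x R :: real assume x: "c \<le> x" "x \<le> c'" and R: "1 \<le> R"
      have "\<tau> * x \<le> \<bar>\<tau> * x\<bar>" by simp
      also have "\<dots> \<le> \<bar>\<tau>\<bar> * max \<bar>c\<bar> \<bar>c'\<bar>" unfolding abs_mult
        using x by (intro mult_left_mono) auto
      finally have "exp (\<tau> * x) \<le> E" by (simp add: E_def)
      hence E: "norm (exp (of_real \<tau> * Complex x r)) \<le> E" for r by simp
      have "norm (deriv F (Complex x r)) \<le> K * R powr (-\<mu> - 1)" if "\<bar>r\<bar> = R" for r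
        using K(3)[of "Complex x r"] R x that by auto
      hence "norm (f (Complex x r)) \<le> K * R powr (-\<mu> - 1) * E" if "\<bar>r\<bar> = R" for r
        unfolding f_def norm_mult using E that K(1) by (intro mult_mono) auto
      thus "norm (f (Complex x R)) \<le> K * R powr (-\<mu> - 1) * E \<and> norm (f (Complex x (-R))) \<le> K * R powr (-\<mu> - 1) * E"
        using R by simp
    qed simp
    hence "vertical_integral f c' = vertical_integral f c" by simp
    thus ?thesis unfolding deriv_inversion_def f_def[symmetric] by (rule sym)
  qed
  consider "c < c'" | "c = c'" | "c' < c" by linarith
  thus ?thesis
  proof cases
    case 1
    show ?thesis by (rule less[OF assms(1) 1])
  next
    case 3
    show ?thesis by (rule less[OF assms(2) 3, symmetric])
  qed simp
qed

text \<open>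
  Closing the contour on the right: for \<open>\<tau> \<le> 0\<close> the exponential factor is bounded as the abscissa \<open>c + v\<close>
  tends to infinity, and \<open>(1 + v) powr (-\<mu>)\<close> tends to zero.
\<close>
lemma deriv_inversion_nonpos:
  assumes "c > \<gamma>" "\<tau> \<le> 0"
  shows "deriv_inversion c \<tau> = 0"
proof -
  obtain M where M: "M \<ge> 0" "\<And>v \<tau>. v \<ge> 0 \<Longrightarrow>
    norm (deriv_inversion (c + v) \<tau>) \<le> M * exp (\<tau> * (c + v)) * (1 + v) powr (-\<mu>)"
    using norm_deriv_inversion_le[OF assms(1)] by blast
  have "((\<lambda>v::real. deriv_inversion c \<tau>) \<longlongrightarrow> 0) at_top"
  proof (rule Lim_null_comparison)
    show "((\<lambda>v. M * exp (\<tau> * c) * (1 + v) powr (-\<mu>)) \<longlongrightarrow> 0) at_top"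
      by (intro tendsto_mult_right_zero tendsto_neg_powr
           filterlim_tendsto_add_at_top[OF tendsto_const] filterlim_ident) (use mu_pos in simp)
    show "\<forall>\<^sub>F v in at_top. norm (deriv_inversion c \<tau>) \<le> M * exp (\<tau> * c) * (1 + v) powr (-\<mu>)"
      using eventually_ge_at_top[of 0]
    proof eventually_elim
      case (elim v)
      have "norm (deriv_inversion c \<tau>) = norm (deriv_inversion (c + v) \<tau>)"
        using assms elim by (subst deriv_inversion_abscissa[of c "c + v"]) auto
      also have "\<dots> \<le> M * exp (\<tau> * (c + v)) * (1 + v) powr (-\<mu>)" by (rule M(2)[OF elim])
      also have "\<dots> \<le> M * exp (\<tau> * c) * (1 + v) powr (-\<mu>)"
        using M(1) elim assms(2) by (intro mult_right_mono mult_left_mono) (auto simp: distrib_left mult_nonpos_nonneg)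
      finally show ?case .
    qed
  qed
  thus ?thesis by (simp add: tendsto_const_iff)
qed

text \<open>
  The choice \<open>v = 1 / \<tau>\<close> keeps \<open>exp (\<tau> * v)\<close> constant and turns \<open>(1 + v) powr (-\<mu>)\<close> into \<open>\<tau> powr \<mu>\<close>.
\<close>
lemma norm_deriv_inversion_pos_le:
  assumes "c > \<gamma>"
  obtains M where "M \<ge> 0" "\<And>\<tau>. \<tau> > 0 \<Longrightarrow> norm (deriv_inversion c \<tau>) \<le> M * \<tau> powr \<mu> * exp (c * \<tau>)"
proof -
  obtain M where M: "M \<ge> 0" "\<And>v \<tau>. v \<ge> 0 \<Longrightarrow>
    norm (deriv_inversion (c + v) \<tau>) \<le> M * exp (\<tau> * (c + v)) * (1 + v) powr (-\<mu>)"
    using norm_deriv_inversion_le[OF assms(1)] by blast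
  show ?thesis
  proof (rule that[of "M * exp 1"])
    fix \<tau> :: real assume \<tau>: "\<tau> > 0"
    have "1 / \<tau> > 0" using \<tau> by simp
    hence "c + 1 / \<tau> > \<gamma>" using assms by linarith
    hence "norm (deriv_inversion c \<tau>) = norm (deriv_inversion (c + 1 / \<tau>) \<tau>)"
      by (simp only: deriv_inversion_abscissa[OF assms])
    also have "\<dots> \<le> M * exp (\<tau> * (c + 1 / \<tau>)) * (1 + 1 / \<tau>) powr (-\<mu>)"
      using \<tau> by (intro M(2)) auto
    also have "\<dots> \<le> M * exp (\<tau> * (c + 1 / \<tau>)) * (1 / \<tau>) powr (-\<mu>)"
      using \<tau> mu_pos M(1) by (intro mult_left_mono powr_mono2') auto
    also have "\<dots> = M * exp 1 * \<tau> powr \<mu> * exp (c * \<tau>)"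
      using \<tau> by (simp add: distrib_left exp_add powr_minus powr_divide mult_ac)
    finally show "norm (deriv_inversion c \<tau>) \<le> M * exp 1 * \<tau> powr \<mu> * exp (c * \<tau>)" .
  qed (use M in auto)
qed

text \<open>
  Here an integral that in general converges only conditionally is reduced to an absolutely convergent
  one: \<open>F * exp (\<tau> * z) / \<tau>\<close> has derivative \<open>F * exp (\<tau> * z) + F' * exp (\<tau> * z) / \<tau>\<close> and tends to zero
  at both ends of the line.
\<close>
lemma has_vertical_line_integral_by_parts:
  assumes c: "c > \<gamma>" and \<tau>: "\<tau> \<noteq> 0"
  shows "has_vertical_line_integral (\<lambda>z. F z * exp (of_real \<tau> * z)) c
           (- \<i> * deriv_inversion c \<tau> / of_real \<tau>)"
  unfolding has_vertical_line_integral_def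
proof (intro conjI allI impI)
  let ?S = "{z. Re z > \<gamma>}"
  let ?f = "\<lambda>z. F z * exp (of_real \<tau> * z)" and ?g = "\<lambda>z. deriv F z * exp (of_real \<tau> * z)"
  let ?P = "\<lambda>z. F z * exp (of_real \<tau> * z) / of_real \<tau>"
  let ?l = "\<lambda>R. linepath (Complex c (-R)) (Complex c R)"
  have S: "open ?S" by (rule open_halfspace_Re_gt)
  have seg: "closed_segment (Complex c (-R)) (Complex c R) \<subseteq> ?S" for R
    using c by (auto simp: closed_segment_same_Re)
  have cf: "?f contour_integrable_on ?l R" for R
    by (intro contour_integrable_continuous_linepath continuous_on_subset[OF _ seg] continuous_intros
          holomorphic_on_imp_continuous_on holomorphic)
  have cg: "?g contour_integrable_on ?l R" for R
    by (intro contour_integrable_continuous_linepath continuous_on_subset[OF _ seg] continuous_intros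
          holomorphic_on_imp_continuous_on deriv_holomorphic)
  show "?f contour_integrable_on ?l R" for R by (rule cf)
  have eq: "contour_integral (?l R) ?f =
     ?P (Complex c R) - ?P (Complex c (-R)) - contour_integral (?l R) ?g / of_real \<tau>" for R
  proof -
    have "((\<lambda>z. ?f z + ?g z / of_real \<tau>) has_contour_integral (?P (pathfinish (?l R)) - ?P (pathstart (?l R)))) (?l R)"
    proof (rule contour_integral_primitive[where S = ?S])
      fix z assume "z \<in> ?S"
      hence "(F has_field_derivative deriv F z) (at z)"
        using holomorphic S by (auto intro: holomorphic_derivI)
      hence "(?P has_field_derivative ?f z + ?g z / of_real \<tau>) (at z)"
        using \<tau> by (auto intro!: derivative_eq_intros simp: field_simps)
      thus "(?P has_field_derivative ?f z + ?g z / of_real \<tau>) (at z within ?S)"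
        by (rule has_field_derivative_at_within)
    qed (use seg in auto)
    hence "contour_integral (?l R) (\<lambda>z. ?f z + ?g z / of_real \<tau>) = ?P (Complex c R) - ?P (Complex c (-R))"
      by (simp add: contour_integral_unique)
    moreover have "contour_integral (?l R) (\<lambda>z. ?f z + ?g z / of_real \<tau>) =
       contour_integral (?l R) ?f + contour_integral (?l R) ?g / of_real \<tau>"
      by (subst contour_integral_add[OF cf contour_integrable_div[OF cg]]) (simp only: contour_integral_div[OF cg])
    ultimately show ?thesis by (simp add: algebra_simps)
  qed
  obtain K where K: "K \<ge> 0"
    "\<And>z. Re z \<ge> c \<Longrightarrow> Im z \<noteq> 0 \<Longrightarrow> norm (F z) \<le> K * \<bar>Im z\<bar> powr (-\<mu>)"
    "\<And>z. Re z \<ge> c \<Longrightarrow> Im z \<noteq> 0 \<Longrightarrow> norm (deriv F z) \<le> K * \<bar>Im z\<bar> powr (-\<mu> - 1)"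
    using decay_horizontal[OF c] by blast
  have P0: "((\<lambda>R. ?P (Complex c (e * R))) \<longlongrightarrow> 0) at_top" if "e = 1 \<or> e = -1" for e
  proof (rule Lim_null_comparison)
    show "((\<lambda>R. K * R powr (-\<mu>) * exp (\<tau> * c) / \<bar>\<tau>\<bar>) \<longlongrightarrow> 0) at_top"
      by (intro tendsto_divide_zero tendsto_mult_left_zero tendsto_mult_right_zero
           tendsto_neg_powr filterlim_ident) (use mu_pos in simp)
    show "\<forall>\<^sub>F R in at_top. norm (?P (Complex c (e * R))) \<le> K * R powr (-\<mu>) * exp (\<tau> * c) / \<bar>\<tau>\<bar>"
      using eventually_gt_at_top[of 0]
    proof eventually_elim
      case (elim R)
      have "norm (F (Complex c (e * R))) \<le> K * R powr (-\<mu>)"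
        using K(2)[of "Complex c (e * R)"] elim that by (auto simp: abs_mult)
      hence "norm (F (Complex c (e * R))) * exp (\<tau> * c) / \<bar>\<tau>\<bar> \<le> K * R powr (-\<mu>) * exp (\<tau> * c) / \<bar>\<tau>\<bar>"
        by (intro divide_right_mono mult_right_mono) auto
      thus ?case by (simp add: norm_mult norm_divide)
    qed
  qed
  have "((\<lambda>R. ?P (Complex c R) - ?P (Complex c (-R)) - contour_integral (?l R) ?g / of_real \<tau>) \<longlongrightarrow>
      0 - 0 - (\<i> * vertical_integral ?g c) / of_real \<tau>) at_top"
  proof (intro tendsto_diff tendsto_divide)
    show "((\<lambda>R. ?P (Complex c R)) \<longlongrightarrow> 0) at_top" "((\<lambda>R. ?P (Complex c (- R))) \<longlongrightarrow> 0) at_top"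
      using P0[of 1] P0[of "-1"] by simp_all
    show "((\<lambda>R. contour_integral (?l R) ?g) \<longlongrightarrow> \<i> * vertical_integral ?g c) at_top"
      by (intro contour_integral_tendsto_vertical_integral integrable_deriv_inversion c)
  qed (use \<tau> in auto)
  thus "((\<lambda>R. contour_integral (?l R) ?f) \<longlongrightarrow> - \<i> * deriv_inversion c \<tau> / of_real \<tau>) at_top"
    unfolding eq by (simp add: deriv_inversion_def)
qed

lemma borel_measurable_pair_deriv [measurable]:
  assumes "c > \<gamma>"
  shows "(\<lambda>(t, \<tau>). deriv F (Complex c t) * exp (of_real \<tau> * (Complex c t - s)))
           \<in> borel_measurable (lborel \<Otimes>\<^sub>M lborel)"
proof -
  have [measurable]: "(\<lambda>t. deriv F (Complex c t)) \<in> borel_measurable lborel"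
    using measurable_vertical[OF assms] by simp
  have "(\<lambda>t. Complex c t) \<in> borel_measurable borel" unfolding Complex_eq by measurable
  hence [measurable]: "(\<lambda>t. Complex c t) \<in> borel_measurable lborel" by simp
  show ?thesis unfolding split_beta by measurable
qed

lemma borel_measurable_deriv_inversion [measurable]:
  assumes "c > \<gamma>"
  shows "deriv_inversion c \<in> borel_measurable lborel"
proof -
  have [measurable]: "(\<lambda>t. deriv F (Complex c t)) \<in> borel_measurable lborel"
    using measurable_vertical[OF assms] by simp
  have "(\<lambda>t. Complex c t) \<in> borel_measurable borel" unfolding Complex_eq by measurable
  hence [measurable]: "(\<lambda>t. Complex c t) \<in> borel_measurable lborel" by simp
  have "(\<lambda>\<tau>. LINT t|lborel. deriv F (Complex c t) * exp (of_real \<tau> * Complex c t)) \<in> borel_measurable lborel"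
    by (rule lborel.borel_measurable_lebesgue_integral) (unfold split_beta, measurable)
  thus ?thesis by (simp add: deriv_inversion_def[abs_def] vertical_integral_def)
qed

text \<open>
  On a line with abscissa \<open>c1 < Re s\<close>, Fubini's theorem turns the left-hand side into the integral of
  \<open>F' z / (s - z)\<close>. Moving that line to the right past \<open>s\<close> picks up \<open>2 * \<pi> * F' s\<close>, and the integral over the line
  moved tends to zero.
\<close>
lemma laplace_deriv_inversion:
  assumes c: "c > \<gamma>" and s: "Re s > \<gamma>"
  shows "(LINT \<tau>:{0<..}|lborel. deriv_inversion c \<tau> * exp (- of_real \<tau> * s)) = 2 * pi * deriv F s"
proof -
  \<comment> \<open>By \<open>deriv_inversion_abscissa\<close> any line between \<open>\<gamma>\<close> and \<open>s\<close> may replace the one at \<open>c\<close>.\<close>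
  define c1 where "c1 = (\<gamma> + Re s) / 2"
  have c1: "c1 > \<gamma>" "c1 < Re s" using s by (auto simp: c1_def)
  define f where "f = (\<lambda>t \<tau>. indicator {0<..} \<tau> *\<^sub>R (deriv F (Complex c1 t) * exp (of_real \<tau> * (Complex c1 t - s))))"
  have re: "Re (s - Complex c1 t) > 0" for t using c1 by simp
  have f_exp: "f t \<tau> = deriv F (Complex c1 t) * (indicator {0<..} \<tau> *\<^sub>R exp (- of_real \<tau> * (s - Complex c1 t)))" for t \<tau>
    by (simp add: f_def algebra_simps)
  have int_exp: "integrable lborel (\<lambda>\<tau>. indicator {0<..} \<tau> *\<^sub>R exp (- of_real \<tau> * (s - Complex c1 t)))"
    "(LINT \<tau>|lborel. indicator {0<..} \<tau> *\<^sub>R exp (- of_real \<tau> * (s - Complex c1 t))) = 1 / (s - Complex c1 t)" for t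
    using integrable_exp_minus[OF re[of t]] by (simp_all add: set_integrable_def set_lebesgue_integral_def)
  \<comment> \<open>The norm of the exponential depends only on \<open>Re (s - Complex c1 t) = Re s - c1\<close>, so \<open>t\<close> may be replaced by \<open>0\<close>.\<close>
  define d where "d = (LINT \<tau>|lborel. norm (indicator {0<..} \<tau> *\<^sub>R exp (- of_real \<tau> * (s - Complex c1 0))))"
  have nf: "norm (f t \<tau>) = norm (deriv F (Complex c1 t)) * norm (indicator {0<..} \<tau> *\<^sub>R exp (- of_real \<tau> * (s - Complex c1 0)))" for t \<tau>
    by (simp add: f_exp norm_mult)
  have [measurable]: "case_prod f \<in> borel_measurable (lborel \<Otimes>\<^sub>M lborel)"
    using borel_measurable_pair_deriv[OF c1(1), of s] unfolding f_def split_beta by measurable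
  have int_f: "integrable (lborel \<Otimes>\<^sub>M lborel) (case_prod f)"
  proof (rule lborel_pair.Fubini_integrable)
    have "integrable lborel (\<lambda>t. norm (deriv F (Complex c1 t)) * d)"
      by (intro integrable_mult_left integrable_norm integrable_deriv_vertical c1)
    thus "integrable lborel (\<lambda>t. LINT \<tau>|lborel. norm (case (t, \<tau>) of (t, \<tau>) \<Rightarrow> f t \<tau>))"
      by (simp add: nf d_def del: norm_scaleR)
    show "AE t in lborel. integrable lborel (\<lambda>\<tau>. case (t, \<tau>) of (t, \<tau>) \<Rightarrow> f t \<tau>)"
      unfolding prod.case f_exp by (intro AE_I2 integrable_mult_right int_exp)
  qed simp
  have "(LINT \<tau>|lborel. LINT t|lborel. f t \<tau>) = (LINT t|lborel. LINT \<tau>|lborel. f t \<tau>)"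
    by (rule lborel_pair.Fubini_integral[OF int_f])
  also have "(\<lambda>t. LINT \<tau>|lborel. f t \<tau>) = (\<lambda>t. deriv F (Complex c1 t) / (s - Complex c1 t))"
    unfolding f_exp integral_mult_right_zero int_exp(2) by simp
  also have "(\<lambda>\<tau>. LINT t|lborel. f t \<tau>) = (\<lambda>\<tau>. indicator {0<..} \<tau> *\<^sub>R (deriv_inversion c \<tau> * exp (- of_real \<tau> * s)))"
  proof
    fix \<tau> :: real
    have "f t \<tau> = indicator {0<..} \<tau> *\<^sub>R (deriv F (Complex c1 t) * exp (of_real \<tau> * Complex c1 t) * exp (- of_real \<tau> * s))" for t
      by (simp add: f_def mult.assoc flip: exp_add) (simp add: algebra_simps)
    thus "(LINT t|lborel. f t \<tau>) = indicator {0<..} \<tau> *\<^sub>R (deriv_inversion c \<tau> * exp (- of_real \<tau> * s))"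
      unfolding deriv_inversion_abscissa[OF c c1(1)] by (simp add: deriv_inversion_def vertical_integral_def)
  qed
  finally have eq: "(LINT \<tau>:{0<..}|lborel. deriv_inversion c \<tau> * exp (- of_real \<tau> * s))
      = (LINT t|lborel. deriv F (Complex c1 t) / (s - Complex c1 t))"
    by (simp add: set_lebesgue_integral_def)
  define h where "h = (\<lambda>z. deriv F z / (z - s))"
  obtain K where K: "K \<ge> 0"
    "\<And>v t. v \<ge> 0 \<Longrightarrow> norm (deriv F (Complex (c1 + v) t)) \<le> K * norm (Complex (1 + v) t) powr (-\<mu> - 1)"
    using deriv_decay_vertical[OF c1(1)] by blast
  obtain K' where K': "K' \<ge> 0"
      "\<And>z. Re z \<ge> c1 \<Longrightarrow> Im z \<noteq> 0 \<Longrightarrow> norm (deriv F z) \<le> K' * \<bar>Im z\<bar> powr (-\<mu> - 1)"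
    using decay_horizontal[OF c1(1)] by blast
  have h_bound: "norm (h (Complex x t)) \<le> norm (deriv F (Complex x t)) / \<bar>x - Re s\<bar>" if "x \<noteq> Re s" for x t
  proof -
    have "\<bar>x - Re s\<bar> \<le> norm (Complex x t - s)" using abs_Re_le_cmod[of "Complex x t - s"] by simp
    thus ?thesis unfolding h_def norm_divide using that
      by (intro divide_left_mono mult_pos_pos) auto
  qed
  have int_h: "integrable lborel (\<lambda>t. h (Complex x t))" if "x > \<gamma>" "x \<noteq> Re s" for x
  proof (rule Bochner_Integration.integrable_bound)
    show "integrable lborel (\<lambda>t. deriv F (Complex x t) /\<^sub>R \<bar>x - Re s\<bar>)"
      by (intro integrable_scaleR_right integrable_deriv_vertical that)
    have [measurable]: "(\<lambda>t. deriv F (Complex x t)) \<in> borel_measurable borel"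
      using measurable_vertical[OF that(1)] by simp
    have [measurable]: "(\<lambda>t. Complex x t) \<in> borel_measurable borel" unfolding Complex_eq by measurable
    show "(\<lambda>t. h (Complex x t)) \<in> borel_measurable lborel" unfolding h_def measurable_lborel1 by measurable
    show "AE t in lborel. norm (h (Complex x t)) \<le> norm (deriv F (Complex x t) /\<^sub>R \<bar>x - Re s\<bar>)"
      using h_bound[OF that(2)] by (simp add: divide_inverse mult.commute)
  qed
  have shift: "vertical_integral h x - vertical_integral h c1 = 2 * pi * deriv F s" if x: "x > Re s" for x
  proof (rule vertical_integral_difference[where \<gamma> = \<gamma> and s = s and \<beta> = "\<lambda>R. K' * R powr (-\<mu> - 1)" and ?R0.0 = "\<bar>Im s\<bar> + 1"])
    show "deriv F holomorphic_on {z. Re z > \<gamma>}" by (rule deriv_holomorphic)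
    show "((\<lambda>R. K' * R powr (-\<mu> - 1)) \<longlongrightarrow> 0) at_top"
      by (intro tendsto_mult_right_zero tendsto_neg_powr filterlim_ident) (use mu_pos in simp)
    show "integrable lborel (\<lambda>t. h (Complex c1 t))" "integrable lborel (\<lambda>t. h (Complex x t))"
      using c1 x by (auto intro!: int_h)
    fix y R assume y: "c1 \<le> y" and R: "\<bar>Im s\<bar> + 1 \<le> R"
    have "norm (h (Complex y r)) \<le> K' * R powr (-\<mu> - 1)" if r: "\<bar>r\<bar> = R" for r
    proof -
      have "1 \<le> \<bar>r - Im s\<bar>" using r R by linarith
      also have "\<dots> \<le> norm (Complex y r - s)" using abs_Im_le_cmod[of "Complex y r - s"] by simp
      finally have "norm (h (Complex y r)) \<le> norm (deriv F (Complex y r)) / 1"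
        unfolding h_def norm_divide by (intro divide_left_mono) auto
      also have "\<dots> \<le> K' * R powr (-\<mu> - 1)" using K'(2)[of "Complex y r"] y R r by auto
      finally show ?thesis .
    qed
    thus "norm (h (Complex y R)) \<le> K' * R powr (-\<mu> - 1) \<and> norm (h (Complex y (-R))) \<le> K' * R powr (-\<mu> - 1)"
      using R by simp
  qed (use c1 x in \<open>auto simp: h_def\<close>)
  obtain M where M: "\<And>v \<tau>. v \<ge> 0 \<Longrightarrow> norm (LINT t|lborel. norm (deriv F (Complex (c1 + v) t))) \<le> M"
  proof -
    define W where "W = (LINT t|lborel. K * norm (Complex 1 t) powr (-(\<mu> + 1)))"
    have "norm (LINT t|lborel. norm (deriv F (Complex (c1 + v) t))) \<le> W" if v: "v \<ge> 0" for v
    proof -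
      have "(LINT t|lborel. norm (deriv F (Complex (c1 + v) t))) \<le> W" unfolding W_def
      proof (rule integral_mono)
        show "integrable lborel (\<lambda>t. norm (deriv F (Complex (c1 + v) t)))"
          using c1 v by (intro integrable_norm integrable_deriv_vertical) auto
        show "integrable lborel (\<lambda>t. K * norm (Complex 1 t) powr (-(\<mu> + 1)))"
          using mu_pos by (intro integrable_mult_right integrable_norm_Complex_powr(1)) auto
        fix t
        have "norm (Complex 1 t) \<le> norm (Complex (1 + v) t)"
          using v by (simp add: complex_norm power_mono)
        moreover have "norm (Complex 1 t) > 0" by (simp add: complex_eq_iff)
        ultimately have "norm (Complex (1 + v) t) powr (-(\<mu> + 1)) \<le> norm (Complex 1 t) powr (-(\<mu> + 1))"
          using mu_pos by (intro powr_mono2') auto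
        hence "K * norm (Complex (1 + v) t) powr (-(\<mu> + 1)) \<le> K * norm (Complex 1 t) powr (-(\<mu> + 1))"
          using K(1) by (rule mult_left_mono)
        thus "norm (deriv F (Complex (c1 + v) t)) \<le> K * norm (Complex 1 t) powr (-(\<mu> + 1))"
          using K(2)[OF v, of t] by simp
      qed
      thus ?thesis by (simp add: Bochner_Integration.integral_nonneg)
    qed
    thus ?thesis using that by blast
  qed
  have "((\<lambda>x. vertical_integral h x) \<longlongrightarrow> 0) at_top"
  proof (rule Lim_null_comparison)
    have "filterlim (\<lambda>x. - Re s + x) at_top at_top"
      by (rule filterlim_tendsto_add_at_top[OF tendsto_const filterlim_ident])
    hence "((\<lambda>x. M / (- Re s + x)) \<longlongrightarrow> 0) at_top"
      by (intro tendsto_divide_0[OF tendsto_const] filterlim_at_top_imp_at_infinity)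
    thus "((\<lambda>x. M / (x - Re s)) \<longlongrightarrow> 0) at_top" by simp
    show "\<forall>\<^sub>F x in at_top. norm (vertical_integral h x) \<le> M / (x - Re s)"
      using eventually_gt_at_top[of "Re s"]
    proof eventually_elim
      case (elim x)
      have x: "x > \<gamma>" "x \<noteq> Re s" "x - c1 \<ge> 0" using elim s c1 by auto
      have "norm (vertical_integral h x) \<le> (LINT t|lborel. norm (h (Complex x t)))"
        unfolding vertical_integral_def by (rule integral_norm_bound)
      also have "\<dots> \<le> (LINT t|lborel. norm (deriv F (Complex x t)) / \<bar>x - Re s\<bar>)"
        using x by (intro integral_mono h_bound integrable_norm int_h integrable_divide integrable_deriv_vertical)
      also have "\<dots> = (LINT t|lborel. norm (deriv F (Complex x t))) / (x - Re s)"
        using elim by simp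
      also have "\<dots> \<le> M / (x - Re s)"
        using M[OF x(3)] elim by (intro divide_right_mono) auto
      finally show ?case .
    qed
  qed
  moreover have "((\<lambda>x. vertical_integral h x) \<longlongrightarrow> vertical_integral h c1 + 2 * pi * deriv F s) at_top"
  proof (rule tendsto_eventually, rule eventually_mono[OF eventually_gt_at_top[of "Re s"]])
    fix x assume "x > Re s"
    from shift[OF this] show "vertical_integral h x = vertical_integral h c1 + 2 * pi * deriv F s"
      by (simp add: algebra_simps)
  qed
  ultimately have "0 = vertical_integral h c1 + 2 * pi * deriv F s"
    by (rule tendsto_unique[OF trivial_limit_at_top_linorder])
  moreover have "(LINT t|lborel. deriv F (Complex c1 t) / (s - Complex c1 t)) = - vertical_integral h c1"
  proof -
    have "deriv F (Complex c1 t) / (s - Complex c1 t) = - h (Complex c1 t)" for t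
      unfolding h_def by (metis minus_diff_eq minus_divide_right)
    thus ?thesis by (simp add: vertical_integral_def)
  qed
  ultimately show ?thesis using eq by (simp add: add_eq_0_iff)
qed

text \<open>
  The value of \<open>H\<close> at \<open>x = \<rho> * exp (- \<tau>)\<close> for \<open>\<tau> \<noteq> 0\<close>. It is obtained from the inversion integral of \<open>F\<close> by
  \<open>has_vertical_line_integral_by_parts\<close>, including the factor \<open>1 / (2 * \<pi> * \<i>)\<close>.
\<close>
definition inversion :: "real \<Rightarrow> real \<Rightarrow> complex" where
  "inversion c \<tau> = - deriv_inversion c \<tau> / (2 * pi * \<tau>)"

lemma integrable_laplace_inversion:
  assumes c: "c > \<gamma>" and s: "Re s > \<gamma>"
  shows "set_integrable lborel {0<..} (\<lambda>\<tau>. inversion c \<tau> * exp (- of_real \<tau> * s))"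
proof -
  \<comment> \<open>An abscissa to the left of \<open>s\<close>, so that the bound \<open>exp (c1 * \<tau>)\<close> loses against \<open>exp (- \<tau> * Re s)\<close>.\<close>
  define c1 where "c1 = (\<gamma> + Re s) / 2"
  have c1: "c1 > \<gamma>" "c1 < Re s" using s by (auto simp: c1_def)
  obtain M where M: "M \<ge> 0" "\<And>\<tau>. \<tau> > 0 \<Longrightarrow> norm (deriv_inversion c1 \<tau>) \<le> M * \<tau> powr \<mu> * exp (c1 * \<tau>)"
    using norm_deriv_inversion_pos_le[OF c1(1)] by blast
  have "integrable lborel (\<lambda>\<tau>. M * (indicator {0<..} \<tau> *\<^sub>R (\<tau> powr (\<mu> - 1) * exp (- (Re s - c1) * \<tau>))))"
    using set_integrable_powr_times_exp[OF mu_pos, of "Re s - c1"] c1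
    by (intro integrable_mult_right) (simp add: set_integrable_def)
  thus ?thesis unfolding set_integrable_def
  proof (rule Bochner_Integration.integrable_bound)
    have [measurable]: "deriv_inversion c \<in> borel_measurable borel"
      using borel_measurable_deriv_inversion[OF c] by simp
    show "(\<lambda>\<tau>. indicator {0<..} \<tau> *\<^sub>R (inversion c \<tau> * exp (- of_real \<tau> * s))) \<in> borel_measurable lborel"
      unfolding inversion_def measurable_lborel1 by measurable
    show "AE \<tau> in lborel. norm (indicator {0<..} \<tau> *\<^sub>R (inversion c \<tau> * exp (- of_real \<tau> * s)))
       \<le> norm (M * (indicator {0<..} \<tau> *\<^sub>R (\<tau> powr (\<mu> - 1) * exp (- (Re s - c1) * \<tau>))))"
    proof (rule AE_I2)
      fix \<tau> :: real
      show "norm (indicator {0<..} \<tau> *\<^sub>R (inversion c \<tau> * exp (- of_real \<tau> * s)))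
       \<le> norm (M * (indicator {0<..} \<tau> *\<^sub>R (\<tau> powr (\<mu> - 1) * exp (- (Re s - c1) * \<tau>))))"
      proof (cases "\<tau> > 0")
        case True
        have "1 \<le> 2 * pi" using pi_ge_two by linarith
        have "norm (inversion c \<tau> * exp (- of_real \<tau> * s))
            = norm (deriv_inversion c1 \<tau>) / (2 * pi * \<tau>) * exp (- \<tau> * Re s)"
          using True by (simp add: inversion_def norm_mult norm_divide deriv_inversion_abscissa[OF c c1(1)])
        also have "\<dots> \<le> (M * \<tau> powr \<mu> * exp (c1 * \<tau>)) / (1 * \<tau>) * exp (- \<tau> * Re s)"
          using True M(1) M(2)[OF True] \<open>1 \<le> 2 * pi\<close>
          by (intro mult_right_mono frac_le mult_nonneg_nonneg) auto
        also have "\<dots> = M * (\<tau> powr (\<mu> - 1) * (exp (c1 * \<tau>) * exp (- \<tau> * Re s)))"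
          using True by (simp add: powr_diff)
        also have "exp (c1 * \<tau>) * exp (- \<tau> * Re s) = exp (- (Re s - c1) * \<tau>)"
          unfolding exp_add[symmetric] by (simp add: algebra_simps)
        finally show ?thesis using True M(1) by simp
      qed simp
    qed
  qed
qed

text \<open>
  As \<open>1 / \<tau>\<close> is the integral of \<open>exp (- x * \<tau>)\<close> over \<open>x > 0\<close>, Fubini's theorem and \<open>laplace_deriv_inversion\<close> turn
  the left-hand side into \<open>-\<close> the integral of \<open>F' (s + x)\<close> over \<open>x > 0\<close>. This is \<open>F s\<close>, because \<open>F\<close> vanishes at
  infinity.
\<close>
lemma laplace_inversion:
  assumes c: "c > \<gamma>" and s: "Re s > \<gamma>"
  shows "(LINT \<tau>:{0<..}|lborel. inversion c \<tau> * exp (- of_real \<tau> * s)) = F s"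
proof -
  define f where "f = (\<lambda>\<tau> x. indicator {0<..} \<tau> *\<^sub>R (deriv_inversion c \<tau> * exp (- of_real \<tau> * s)) *
     (indicator {0<..} x *\<^sub>R exp (- of_real x * of_real \<tau>)))"
  have [measurable]: "deriv_inversion c \<in> borel_measurable borel"
    using borel_measurable_deriv_inversion[OF c] by simp
  have m: "case_prod f \<in> borel_measurable (lborel \<Otimes>\<^sub>M lborel)"
    unfolding f_def split_beta by measurable
  have int_exp: "integrable lborel (\<lambda>x. indicator {0<..} x *\<^sub>R exp (- of_real x * complex_of_real \<tau>))"
    "(LINT x|lborel. indicator {0<..} x *\<^sub>R exp (- of_real x * complex_of_real \<tau>)) = 1 / of_real \<tau>" if "\<tau> > 0" for \<tau>
    using integrable_exp_minus[of "of_real \<tau>"] that by (simp_all add: set_integrable_def set_lebesgue_integral_def)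
  have int_norm: "(LINT x|lborel. norm (indicator {0<..} x *\<^sub>R exp (- of_real x * complex_of_real \<tau>))) = 1 / \<tau>" if "\<tau> > 0" for \<tau>
  proof -
    have "complex_of_real (LINT x|lborel. norm (indicator {0<..} x *\<^sub>R exp (- of_real x * complex_of_real \<tau>)))
       = (LINT x|lborel. complex_of_real (norm (indicator {0<..} x *\<^sub>R exp (- of_real x * complex_of_real \<tau>))))"
      by (rule integral_complex_of_real[symmetric])
    also have "\<dots> = (LINT x|lborel. indicator {0<..} x *\<^sub>R exp (- of_real x * complex_of_real \<tau>))"
      by (intro Bochner_Integration.integral_cong) (auto simp: indicator_def exp_of_real[symmetric])
    also have "\<dots> = of_real (1 / \<tau>)" using int_exp(2)[OF that] by simp
    finally show ?thesis by (simp only: of_real_eq_iff)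
  qed
  have inner: "(LINT x|lborel. f \<tau> x) = - 2 * pi * (indicator {0<..} \<tau> *\<^sub>R (inversion c \<tau> * exp (- of_real \<tau> * s)))" for \<tau>
  proof (cases "\<tau> > 0")
    case True
    show ?thesis unfolding f_def integral_mult_right_zero int_exp(2)[OF True]
      using True by (simp add: inversion_def)
  qed (simp add: f_def)
  have inner_norm: "(LINT x|lborel. norm (f \<tau> x)) = 2 * pi * norm (indicator {0<..} \<tau> *\<^sub>R (inversion c \<tau> * exp (- of_real \<tau> * s)))" for \<tau>
  proof (cases "\<tau> > 0")
    case True
    have "(LINT x|lborel. norm (f \<tau> x)) = norm (deriv_inversion c \<tau> * exp (- of_real \<tau> * s)) * (1 / \<tau>)"
      unfolding f_def norm_mult[of "indicator {0<..} \<tau> *\<^sub>R (deriv_inversion c \<tau> * exp (- of_real \<tau> * s))"]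
        integral_mult_right_zero int_norm[OF True] using True by simp
    thus ?thesis using True by (simp add: inversion_def norm_mult norm_divide)
  qed (simp add: f_def)
  have int_f: "integrable (lborel \<Otimes>\<^sub>M lborel) (case_prod f)"
  proof (rule lborel_pair.Fubini_integrable[OF m])
    show "integrable lborel (\<lambda>\<tau>. LINT x|lborel. norm (case (\<tau>, x) of (\<tau>, x) \<Rightarrow> f \<tau> x))"
      unfolding prod.case inner_norm using integrable_laplace_inversion[OF c s]
      by (intro integrable_mult_right integrable_norm) (simp add: set_integrable_def)
    have "integrable lborel (f \<tau>)" for \<tau>
    proof (cases "\<tau> > 0")
      case True
      show ?thesis unfolding f_def by (intro integrable_mult_right int_exp True)
    qed (simp add: f_def)
    thus "AE \<tau> in lborel. integrable lborel (\<lambda>x. case (\<tau>, x) of (\<tau>, x) \<Rightarrow> f \<tau> x)" by simp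
  qed
  have outer: "(LINT \<tau>|lborel. f \<tau> x) = indicator {0<..} x *\<^sub>R (2 * pi * deriv F (s + of_real x))" for x
  proof (cases "x > 0")
    case True
    have "f \<tau> x = indicator {0<..} \<tau> *\<^sub>R (deriv_inversion c \<tau> * exp (- of_real \<tau> * (s + of_real x)))" for \<tau>
      using True by (simp add: f_def distrib_left exp_add exp_diff exp_minus field_simps)
    thus ?thesis using laplace_deriv_inversion[OF c, of "s + of_real x"] s True
      by (simp add: set_lebesgue_integral_def)
  qed (simp add: f_def)
  have "(LINT x|lborel. LINT \<tau>|lborel. f \<tau> x) = (LINT \<tau>|lborel. LINT x|lborel. f \<tau> x)"
    by (rule lborel_pair.Fubini_integral[OF int_f])
  hence eq: "(LINT x|lborel. indicator {0<..} x *\<^sub>R (2 * pi * deriv F (s + of_real x))) =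
      - 2 * pi * (LINT \<tau>:{0<..}|lborel. inversion c \<tau> * exp (- of_real \<tau> * s))"
    unfolding inner outer integral_mult_right_zero by (simp add: set_lebesgue_integral_def)
  let ?G = "\<lambda>x. 2 * pi * deriv F (s + of_real x)"
  \<comment> \<open>The point \<open>0\<close> is added only to have a half-line that is exhausted by compact intervals \<open>{0..b}\<close>.\<close>
  have AE0: "AE x in lborel. indicator {0<..} x *\<^sub>R ?G x = indicator {0..} x *\<^sub>R ?G x"
    using AE_lborel_singleton[of "0::real"] by eventually_elim (auto simp: indicator_def)
  have contG: "continuous_on {0..} ?G"
    using s by (intro continuous_intros continuous_on_compose2[OF holomorphic_on_imp_continuous_on[OF deriv_holomorphic]]) auto
  have mG: "(\<lambda>x. indicator {0..} x *\<^sub>R ?G x) \<in> borel_measurable lborel"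
    using borel_measurable_continuous_on_indicator[OF _ contG] by simp
  have "integrable lborel (\<lambda>x. indicator {0<..} x *\<^sub>R ?G x)"
    using lborel_pair.integrable_snd[OF int_f] unfolding outer .
  hence intG: "set_integrable lborel {0..} ?G"
    unfolding set_integrable_def using AE0 mG by (subst integrable_cong_AE[symmetric]) auto
  have limG: "((\<lambda>b. LINT x:{0..b}|lborel. ?G x) \<longlongrightarrow> (LINT x:{0..}|lborel. ?G x)) at_top"
    by (rule tendsto_set_lebesgue_integral_at_top[OF _ intG]) auto
  have FTC: "(LINT x:{0..b}|lborel. ?G x) = 2 * pi * (F (s + of_real b) - F s)" if "b \<ge> 0" for b
  proof -
    have "(?G has_integral (2 * pi * F (s + of_real b) - 2 * pi * F (s + of_real 0))) {0..b}"
    proof (rule fundamental_theorem_of_calculus[OF that])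
      fix x assume "x \<in> {0..b}"
      hence "Re (s + of_real x) > \<gamma>" using s by auto
      hence "(F has_field_derivative deriv F (s + of_real x)) (at (s + of_real x))"
        by (intro holomorphic_derivI[OF holomorphic open_halfspace_Re_gt]) auto
      hence "((\<lambda>z. 2 * pi * F (s + z)) has_field_derivative ?G x) (at (of_real x))"
        by (auto intro!: derivative_eq_intros DERIV_chain2[of F])
      thus "((\<lambda>x. 2 * pi * F (s + of_real x)) has_vector_derivative ?G x) (at x within {0..b})"
        by (rule has_vector_derivative_real_field)
    qed
    hence "integral {0..b} ?G = 2 * pi * (F (s + of_real b) - F s)"
      by (simp only: integral_unique right_diff_distrib) simp
    moreover have "set_integrable lborel {0..b} ?G"
      by (rule set_integrable_subset[OF intG]) auto
    ultimately show ?thesis by (simp only: set_borel_integral_eq_integral(2))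
  qed
  have F0: "((\<lambda>b::real. F (s + of_real b)) \<longlongrightarrow> 0) at_top"
  proof -
    obtain K where K: "K \<ge> 0" "\<And>z. Re z \<ge> Re s \<Longrightarrow> norm (F z) \<le> K * (1 + norm (z - of_real (Re s))) powr (-\<mu>)"
      using decay[OF s] by blast
    show ?thesis
    proof (rule Lim_null_comparison)
      show "((\<lambda>b. K * b powr (-\<mu>)) \<longlongrightarrow> 0) at_top"
        by (intro tendsto_mult_right_zero tendsto_neg_powr filterlim_ident) (use mu_pos in simp)
      show "\<forall>\<^sub>F b in at_top. norm (F (s + of_real b)) \<le> K * b powr (-\<mu>)"
        using eventually_gt_at_top[of 0]
      proof eventually_elim
        case (elim b)
        have "b \<le> 1 + norm (s + of_real b - of_real (Re s))"
          using abs_Re_le_cmod[of "s + of_real b - of_real (Re s)"] by simp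
        hence "K * (1 + norm (s + of_real b - of_real (Re s))) powr (-\<mu>) \<le> K * b powr (-\<mu>)"
          using elim mu_pos K(1) by (intro mult_left_mono powr_mono2') auto
        thus ?case using K(2)[of "s + of_real b"] elim by simp
      qed
    qed
  qed
  have "((\<lambda>b. 2 * pi * (F (s + of_real b) - F s)) \<longlongrightarrow> 2 * pi * (0 - F s)) at_top"
    by (intro tendsto_mult tendsto_diff tendsto_const F0)
  moreover have "\<forall>\<^sub>F b in at_top. 2 * pi * (F (s + of_real b) - F s) = (LINT x:{0..b}|lborel. ?G x)"
    using eventually_ge_at_top[of 0] by eventually_elim (simp only: FTC)
  ultimately have "((\<lambda>b. LINT x:{0..b}|lborel. ?G x) \<longlongrightarrow> 2 * pi * (0 - F s)) at_top"
    by (rule Lim_transform_eventually)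
  with limG have "(LINT x:{0..}|lborel. ?G x) = 2 * pi * (0 - F s)"
    by (rule tendsto_unique[OF trivial_limit_at_top_linorder])
  moreover have "(LINT x:{0..}|lborel. ?G x) = (LINT x|lborel. indicator {0<..} x *\<^sub>R ?G x)"
    unfolding set_lebesgue_integral_def
    by (rule integral_cong_AE) (use AE0 mG \<open>integrable lborel (\<lambda>x. indicator {0<..} x *\<^sub>R ?G x)\<close> in \<open>auto elim: eventually_mono\<close>)
  ultimately show ?thesis using eq by simp
qed

text \<open>
  The change of variables below is one for continuous integrands.
\<close>
lemma isCont_inversion:
  assumes c: "c > \<gamma>" and \<tau>: "\<tau> \<noteq> 0"
  shows "isCont (inversion c) \<tau>"
proof -
  have "isCont (deriv_inversion c) \<tau>"
    unfolding continuous_at_sequentially o_def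
  proof (intro allI impI)
    fix X assume X: "X \<longlonglongrightarrow> \<tau>"
    then obtain B where B: "\<And>n. \<bar>X n\<bar> \<le> B"
      using convergent_imp_Bseq[of X] by (auto simp: convergent_def Bseq_def)
    show "(\<lambda>n. deriv_inversion c (X n)) \<longlonglongrightarrow> deriv_inversion c \<tau>"
      unfolding deriv_inversion_def vertical_integral_def
    proof (rule integral_dominated_convergence)
      show "integrable lborel (\<lambda>t. norm (deriv F (Complex c t)) * exp (B * \<bar>c\<bar>))"
        by (intro integrable_mult_left integrable_norm integrable_deriv_vertical c)
      show "AE t in lborel. (\<lambda>n. deriv F (Complex c t) * exp (of_real (X n) * Complex c t))
          \<longlonglongrightarrow> deriv F (Complex c t) * exp (of_real \<tau> * Complex c t)"
        by (intro AE_I2 tendsto_intros X)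
      show "AE t in lborel. norm (deriv F (Complex c t) * exp (of_real (X n) * Complex c t))
          \<le> norm (deriv F (Complex c t)) * exp (B * \<bar>c\<bar>)" for n
      proof (rule AE_I2)
        fix t
        have "X n * c \<le> \<bar>X n * c\<bar>" by simp
        also have "\<dots> \<le> B * \<bar>c\<bar>" unfolding abs_mult by (intro mult_right_mono B) auto
        finally show "norm (deriv F (Complex c t) * exp (of_real (X n) * Complex c t))
          \<le> norm (deriv F (Complex c t)) * exp (B * \<bar>c\<bar>)"
          by (simp add: norm_mult mult_left_mono)
      qed
    qed (use integrable_deriv_inversion[OF c] in \<open>auto intro: borel_measurable_integrable\<close>)
  qed
  thus ?thesis unfolding inversion_def[abs_def] using \<tau> by (intro continuous_intros) auto
qed

end

section \<open>The Mellin inversion of the H-function\<close>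

text \<open>
  The substitution \<open>\<tau> = ln (\<rho> / x)\<close>, decreasing in \<open>x\<close>. It is carried out with \<open>v = - \<tau>\<close>, so that
  \<open>x = \<rho> * exp v\<close> is increasing; integrability is transferred through the norm first.
\<close>
lemma logarithmic_substitution:
  fixes k :: "real \<Rightarrow> complex"
  assumes \<rho>: "\<rho> > 0" and cont: "\<And>\<tau>. \<tau> > 0 \<Longrightarrow> isCont k \<tau>" and int: "set_integrable lborel {0<..} k"
  shows "set_integrable lborel {0<..<\<rho>} (\<lambda>x. k (ln \<rho> - ln x) / of_real x)"
    and "(LINT x:{0<..<\<rho>}|lborel. k (ln \<rho> - ln x) / of_real x) = (LINT \<tau>:{0<..}|lborel. k \<tau>)"
proof -
  let ?f = "\<lambda>x. k (ln \<rho> - ln x) / of_real x" and ?g = "\<lambda>v::real. \<rho> * exp v"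
  have E: "einterval (-\<infinity>) 0 = {..<0}" "einterval 0 (ereal \<rho>) = {0<..<\<rho>}"
    by (auto simp: einterval_def zero_ereal_def)
  have fg: "?g v *\<^sub>R ?f (?g v) = k (- v)" for v using \<rho> by (simp add: ln_mult scaleR_conv_of_real)
  have A: "((ereal \<circ> ?g \<circ> real_of_ereal) \<longlongrightarrow> 0) (at_right (-\<infinity>))"
  proof -
    have "((\<lambda>v. \<rho> * exp v) \<longlongrightarrow> \<rho> * 0) at_bot" by (intro tendsto_intros exp_at_bot)
    thus ?thesis unfolding zero_ereal_def comp_assoc[symmetric] ereal_tendsto_simps by simp
  qed
  have B: "((ereal \<circ> ?g \<circ> real_of_ereal) \<longlongrightarrow> ereal \<rho>) (at_left 0)"
  proof -
    have "((\<lambda>v. \<rho> * exp v) \<longlongrightarrow> \<rho> * exp 0) (at_left 0)" by (intro tendsto_intros)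
    thus ?thesis unfolding zero_ereal_def comp_assoc[symmetric] ereal_tendsto_simps by simp
  qed
  have der: "(?g has_real_derivative ?g v) (at v)" for v
    by (auto intro!: derivative_eq_intros)
  have contf: "isCont ?f x" if "0 < x" "x < \<rho>" for x
    using that \<rho> by (intro continuous_intros isCont_o2[OF _ cont]) auto
  have contg: "isCont ?f (?g v)" if "v < 0" for v
    using that \<rho> by (intro contf) (auto simp: mult_less_cancel_left2)
  have ind: "indicator {0<..} (0 + (-1) * v) = (indicator {..<0} v :: real)" for v :: real
    by (auto simp: indicator_def)
  have intk: "set_integrable lborel {..<0} (\<lambda>v. k (- v))"
    using lborel_integrable_real_affine[OF int[unfolded set_integrable_def], of "-1" 0]
    unfolding ind by (simp add: set_integrable_def)
  have nrm: "norm (?f (?g v)) * ?g v = norm (k (- v))" for v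
    using \<rho> by (simp add: norm_divide norm_mult ln_mult)
  have "set_integrable lborel (einterval 0 (ereal \<rho>)) (\<lambda>x. norm (?f x))"
  proof (rule interval_integral_substitution_nonneg(1)[where g = ?g and g' = ?g, OF _ der _ _ _ _ A B])
    show "set_integrable lborel (einterval (-\<infinity>) 0) (\<lambda>v. norm (?f (?g v)) * ?g v)"
      unfolding nrm E using intk by (rule set_integrable_norm)
  qed (use \<rho> contg in \<open>auto simp: zero_ereal_def intro!: continuous_intros less_imp_le\<close>)
  hence intn: "set_integrable lborel {0<..<\<rho>} (\<lambda>x. norm (?f x))" unfolding E .
  show intf: "set_integrable lborel {0<..<\<rho>} ?f"
    using intn unfolding set_integrable_def
  proof (rule Bochner_Integration.integrable_bound)
    have "continuous_on {0<..<\<rho>} ?f"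
      by (intro continuous_at_imp_continuous_on ballI contf) auto
    thus "(\<lambda>x. indicator {0<..<\<rho>} x *\<^sub>R ?f x) \<in> borel_measurable lborel"
      using borel_measurable_continuous_on_indicator[of "{0<..<\<rho>}" ?f] by simp
  qed auto
  have "(LBINT x=0..ereal \<rho>. ?f x) = (LBINT v=-\<infinity>..0. ?g v *\<^sub>R ?f (?g v))"
  proof (rule interval_integral_substitution_integrable[where g = ?g and g' = ?g, OF _ der _ _ _ A B])
    show "set_integrable lborel (einterval (-\<infinity>) 0) (\<lambda>v. ?g v *\<^sub>R ?f (?g v))"
      unfolding fg E by (rule intk)
    show "set_integrable lborel (einterval 0 (ereal \<rho>)) ?f" unfolding E by (rule intf)
  qed (use \<rho> contg in \<open>auto simp: zero_ereal_def intro!: continuous_intros less_imp_le\<close>)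
  hence "(LINT x:{0<..<\<rho>}|lborel. ?f x) = (LINT v:{..<0}|lborel. k (- v))"
    unfolding fg using \<rho> by (simp add: interval_lebesgue_integral_def E)
  also have "\<dots> = (LINT \<tau>:{0<..}|lborel. k \<tau>)"
    using lborel_integral_real_affine[of "-1" "\<lambda>\<tau>. indicator {0<..} \<tau> *\<^sub>R k \<tau>" 0]
    unfolding ind by (simp add: set_lebesgue_integral_def)
  finally show "(LINT x:{0<..<\<rho>}|lborel. ?f x) = (LINT \<tau>:{0<..}|lborel. k \<tau>)" .
qed

lemma vertical_line_integral_eqI:
  assumes "has_vertical_line_integral f c I"
  shows "vertical_line_integral f c = I"
  unfolding vertical_line_integral_def
proof (rule the_equality)
  show "has_vertical_line_integral f c I" by (rule assms)
  fix J assume "has_vertical_line_integral f c J"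
  thus "J = I" using assms tendsto_unique[OF trivial_limit_at_top_linorder]
    unfolding has_vertical_line_integral_def by blast
qed

text \<open>
  For \<open>c > \<gamma>\<close> the translate of the quotient by \<open>c\<close> is again a gamma quotient, with parameters
  \<open>A k * c + a k > 0\<close> and \<open>B j * c + b j\<close>. The translation leaves \<open>\<mu>\<close> unchanged because \<open>\<Sum>A = \<Sum>B\<close>.
\<close>
lemma half_plane_decay_gamma_quotient:
  fixes A a B b :: "nat \<Rightarrow> real"
  assumes A: "\<And>k. k \<in> {1..p} \<Longrightarrow> A k > 0" and B: "\<And>j. j \<in> {1..q} \<Longrightarrow> B j > 0"
    and AB: "(\<Sum>k=1..p. A k) = (\<Sum>j=1..q. B j)"
    and \<gamma>: "\<And>c k. c > \<gamma> \<Longrightarrow> k \<in> {1..p} \<Longrightarrow> A k * c + a k > 0"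
    and \<mu>: "\<mu> = (\<Sum>j=1..q. b j) - (\<Sum>k=1..p. a k) + (real p - real q) / 2" "\<mu> > 0"
    and \<beta>: "\<beta> = (\<Sum>k=1..p. A k * ln (A k)) - (\<Sum>j=1..q. B j * ln (B j))"
  shows "half_plane_decay (\<lambda>z. gamma_quotient p A a q B b z * exp (- of_real \<beta> * z)) \<gamma> \<mu>"
proof
  let ?F = "\<lambda>z. gamma_quotient p A a q B b z * exp (- of_real \<beta> * z)"
  show "\<mu> > 0" by fact
  show hol: "?F holomorphic_on {z. Re z > \<gamma>}"
    by (intro holomorphic_intros holomorphic_on_gamma_quotient) (use \<gamma> in auto)
  fix c assume c: "c > \<gamma>"
  define a' b' where "a' = (\<lambda>k. A k * c + a k)" and "b' = (\<lambda>j. B j * c + b j)"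
  define F' where "F' = (\<lambda>z. gamma_quotient p A a' q B b' z * exp (- of_real \<beta> * z))"
  have "(\<Sum>k=1..p. A k * c) = (\<Sum>j=1..q. B j * c)"
    unfolding sum_distrib_right[symmetric] AB ..
  hence \<mu>': "\<mu> = (\<Sum>j=1..q. b' j) - (\<Sum>k=1..p. a' k) + (real p - real q) / 2"
    by (simp add: \<mu>(1) a'_def b'_def sum.distrib)
  have "\<exists>K\<ge>0. \<forall>z. Re z \<ge> 0 \<longrightarrow> norm (F' z) \<le> K * (1 + norm z) powr (-\<mu>)
            \<and> norm (deriv F' z) \<le> K * (1 + norm z) powr (-\<mu> - 1)"
    by (rule gamma_quotient_decay[OF A _ B AB \<mu>' \<mu>(2) \<beta> F'_def]) (auto simp: a'_def intro!: \<gamma> c)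
  then obtain K where K: "K \<ge> 0" "\<And>z. Re z \<ge> 0 \<Longrightarrow> norm (F' z) \<le> K * (1 + norm z) powr (-\<mu>)
            \<and> norm (deriv F' z) \<le> K * (1 + norm z) powr (-\<mu> - 1)" by blast
  have F': "F' z = ?F (z + of_real c) * exp (of_real (\<beta> * c))" for z
  proof -
    have "gamma_quotient p A a' q B b' z = gamma_quotient p A a q B b (z + of_real c)"
      by (simp add: gamma_quotient_def a'_def b'_def algebra_simps)
    moreover have "exp (- of_real \<beta> * z) = exp (- of_real \<beta> * (z + of_real c)) * exp (of_real (\<beta> * c))"
      unfolding exp_of_real[symmetric] exp_add[symmetric] by (simp add: algebra_simps)
    ultimately show ?thesis by (simp add: F'_def mult.assoc)
  qed
  have dF': "deriv F' z = deriv ?F (z + of_real c) * exp (of_real (\<beta> * c))" if "Re z \<ge> 0" for z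
  proof (rule DERIV_imp_deriv)
    have "(?F has_field_derivative deriv ?F (z + of_real c)) (at (z + of_real c))"
      by (rule holomorphic_derivI[OF hol open_halfspace_Re_gt]) (use that c in auto)
    hence "((\<lambda>z. ?F (z + of_real c)) has_field_derivative deriv ?F (z + of_real c)) (at z)"
      by (simp only: DERIV_shift)
    from DERIV_cmult_right[OF this]
    show "(F' has_field_derivative deriv ?F (z + of_real c) * exp (of_real (\<beta> * c))) (at z)"
      unfolding F'[abs_def] .
  qed
  have *: "norm u \<le> K * exp (- \<beta> * c) * y" if "norm (u * exp (of_real (\<beta> * c))) \<le> K * y" for u :: complex and y
    using that by (simp add: norm_mult exp_minus field_simps)
  show "\<exists>K\<ge>0. \<forall>z. Re z \<ge> c \<longrightarrow>
       norm (?F z) \<le> K * (1 + norm (z - of_real c)) powr (-\<mu>) \<and>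
       norm (deriv ?F z) \<le> K * (1 + norm (z - of_real c)) powr (-\<mu> - 1)"
  proof (intro exI[of _ "K * exp (- \<beta> * c)"] conjI allI impI)
    fix z assume "Re z \<ge> c"
    hence z: "Re (z - of_real c) \<ge> 0" by simp
    show "norm (?F z) \<le> K * exp (- \<beta> * c) * (1 + norm (z - of_real c)) powr (-\<mu>)"
      using K(2)[OF z] by (intro *) (simp add: F')
    show "norm (deriv ?F z) \<le> K * exp (- \<beta> * c) * (1 + norm (z - of_real c)) powr (-\<mu> - 1)"
      using K(2)[OF z] dF'[OF z] by (intro *) simp
  qed (use K in auto)
qed

theorem theorem6:
  fixes p q :: nat and A a B b :: "nat \<Rightarrow> real" and \<gamma> \<rho> \<mu> c :: real
  assumes "p \<ge> 1" and "q \<ge> 1"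
    and "\<And>k. k \<in> {1..p} \<Longrightarrow> A k > 0"
    and "\<And>j. j \<in> {1..q} \<Longrightarrow> B j > 0"
    and "\<gamma> = - Min ((\<lambda>k. a k / A k) ` {1..p})"
    and "\<rho> = (\<Prod>k=1..p. A k powr A k) * (\<Prod>j=1..q. B j powr (- B j))"
    and "\<mu> = (\<Sum>j=1..q. b j) - (\<Sum>k=1..p. a k) + (real p - real q) / 2"
    and "\<mu> > 0"
    and "(\<Sum>i=1..p. A i) = (\<Sum>j=1..q. B j)"
    and "c > \<gamma>"
  shows "(\<forall>x>0. x \<noteq> \<rho> \<longrightarrow> (\<exists>I. has_vertical_line_integral (fox_H_integrand p A a q B b x) c I))
    \<and> (\<forall>c'>\<gamma>. \<forall>x>0. x \<noteq> \<rho> \<longrightarrow> fox_H p A a q B b c' x = fox_H p A a q B b c x)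
    \<and> (\<forall>x>\<rho>. fox_H p A a q B b c x = 0)
    \<and> (\<forall>s::complex. Re s > \<gamma> \<longrightarrow>
         set_integrable lborel {0<..} (\<lambda>x. fox_H p A a q B b c x * of_real x powr (s - 1))
         \<and> (LINT x:{0<..<\<rho>}|lborel. fox_H p A a q B b c x * of_real x powr (s - 1))
             = gamma_quotient p A a q B b s)"
proof -
  note A = assms(3) and B = assms(4)
  define \<beta> where "\<beta> = (\<Sum>k=1..p. A k * ln (A k)) - (\<Sum>j=1..q. B j * ln (B j))"
  have "(\<Prod>k=1..p. A k powr A k) = exp (\<Sum>k=1..p. A k * ln (A k))"
    unfolding exp_sum[OF finite_atLeastAtMost] using A by (intro prod.cong) (force simp: powr_def)+
  moreover have "(\<Prod>j=1..q. B j powr (- B j)) = exp (\<Sum>j=1..q. - (B j * ln (B j)))"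
    unfolding exp_sum[OF finite_atLeastAtMost] using B by (intro prod.cong) (force simp: powr_def)+
  ultimately have "\<rho> = exp \<beta>"
    unfolding assms(6) \<beta>_def by (simp add: sum_negf exp_diff exp_minus divide_inverse)
  hence \<rho>: "\<rho> > 0" "ln \<rho> = \<beta>" by auto
  have \<gamma>: "A k * c + a k > 0" if "c > \<gamma>" "k \<in> {1..p}" for c k
  proof -
    have "Min ((\<lambda>k. a k / A k) ` {1..p}) \<le> a k / A k" using that by (intro Min_le) auto
    hence "- (a k / A k) < c" using that assms(5) by linarith
    thus ?thesis using A[OF that(2)] by (simp add: field_simps)
  qed
  define F where "F = (\<lambda>z. gamma_quotient p A a q B b z * exp (- of_real \<beta> * z))"
  interpret half_plane_decay F \<gamma> \<mu>
    unfolding F_def by (rule half_plane_decay_gamma_quotient[OF A B assms(9) \<gamma> assms(7,8) \<beta>_def])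
  have F: "gamma_quotient p A a q B b z = F z * exp (of_real \<beta> * z)" for z
    by (simp add: F_def mult.assoc flip: exp_add)
  have integrand: "fox_H_integrand p A a q B b x = (\<lambda>z. F z * exp (of_real (\<beta> - ln x) * z))" if "x > 0" for x
    using that by (auto simp: fox_H_integrand_def F powr_def Ln_of_real mult.assoc algebra_simps simp flip: exp_add)
  have hvli: "has_vertical_line_integral (fox_H_integrand p A a q B b x) c'
      (- \<i> * deriv_inversion c' (\<beta> - ln x) / of_real (\<beta> - ln x))" if "x > 0" "x \<noteq> \<rho>" "c' > \<gamma>" for x c'
  proof -
    have "\<beta> - ln x \<noteq> 0" using that \<rho> by (metis eq_iff_diff_eq_0 ln_inj_iff)
    thus ?thesis unfolding integrand[OF that(1)] by (rule has_vertical_line_integral_by_parts[OF that(3)])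
  qed
  have H: "fox_H p A a q B b c' x = inversion c' (\<beta> - ln x)" if "x > 0" "x \<noteq> \<rho>" "c' > \<gamma>" for x c'
    unfolding fox_H_def vertical_line_integral_eqI[OF hvli[OF that]] inversion_def by (simp add: field_simps)
  have H0: "fox_H p A a q B b c x = 0" if "x > \<rho>" for x
  proof -
    have "x > 0" "x \<noteq> \<rho>" "\<beta> - ln x \<le> 0" using that \<rho> by (auto simp flip: \<rho>(2))
    thus ?thesis using assms(10) by (simp add: H inversion_def deriv_inversion_nonpos)
  qed
  have mellin: "set_integrable lborel {0<..} (\<lambda>x. fox_H p A a q B b c x * of_real x powr (s - 1))
         \<and> (LINT x:{0<..<\<rho>}|lborel. fox_H p A a q B b c x * of_real x powr (s - 1))
             = gamma_quotient p A a q B b s" if s: "Re s > \<gamma>" for s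
  proof -
    let ?k = "\<lambda>\<tau>. inversion c \<tau> * exp (- of_real \<tau> * s)"
    let ?h = "\<lambda>x. fox_H p A a q B b c x * of_real x powr (s - 1)"
    let ?C = "exp (of_real \<beta> * s)"
    have cont: "isCont ?k \<tau>" if "\<tau> > 0" for \<tau>
      using isCont_inversion[OF assms(10), of \<tau>] that by (intro continuous_intros) auto
    have h: "?h x = ?C * (?k (ln \<rho> - ln x) / of_real x)" if "x \<in> {0<..<\<rho>}" for x
    proof -
      have "complex_of_real x powr (s - 1) = exp (of_real (ln x) * s) / of_real x"
        using that by (simp add: powr_def Ln_of_real algebra_simps exp_diff exp_of_real)
      also have "exp (of_real (ln x) * s) = ?C * exp (- of_real (ln \<rho> - ln x) * s)"
        unfolding \<rho>(2) exp_add[symmetric] by (simp add: algebra_simps)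
      finally show ?thesis using that assms(10) H[of x c] \<rho> by simp
    qed
    note subst = logarithmic_substitution[OF \<rho>(1) cont integrable_laplace_inversion[OF assms(10) s]]
    have intC: "set_integrable lborel {0<..<\<rho>} (\<lambda>x. ?C * (?k (ln \<rho> - ln x) / of_real x))"
      by (intro set_integrable_mult_right subst(1))
    hence int: "set_integrable lborel {0<..<\<rho>} ?h"
      by (rule set_integrable_cong[THEN iffD1, rotated -1]) (use h in auto)
    have "(LINT x:{0<..<\<rho>}|lborel. ?h x) = (LINT x:{0<..<\<rho>}|lborel. ?C * (?k (ln \<rho> - ln x) / of_real x))"
      by (rule set_lebesgue_integral_cong) (use h in auto)
    also have "\<dots> = ?C * F s"
      by (simp only: set_integral_mult_right subst(2) laplace_inversion[OF assms(10) s])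
    also have "\<dots> = gamma_quotient p A a q B b s" by (simp add: F)
    finally have eq: "(LINT x:{0<..<\<rho>}|lborel. ?h x) = gamma_quotient p A a q B b s" .
    \<comment> \<open>Nothing is known about the value at \<open>x = \<rho>\<close>, but a single point does not affect integrability;
      beyond \<open>\<rho>\<close> the integrand is zero.\<close>
    have "integrable lborel (\<lambda>x. indicator {0<..<\<rho>} x *\<^sub>R ?h x + indicator {\<rho>} x *\<^sub>R ?h \<rho>)"
      using int by (intro Bochner_Integration.integrable_add) (auto simp: set_integrable_def)
    also have "(\<lambda>x. indicator {0<..<\<rho>} x *\<^sub>R ?h x + indicator {\<rho>} x *\<^sub>R ?h \<rho>) = (\<lambda>x. indicator {0<..} x *\<^sub>R ?h x)"
    proof
      fix x :: real
      show "indicator {0<..<\<rho>} x *\<^sub>R ?h x + indicator {\<rho>} x *\<^sub>R ?h \<rho> = indicator {0<..} x *\<^sub>R ?h x"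
        using \<rho>(1) H0[of x] by (cases x \<rho> rule: linorder_cases) (auto simp: indicator_def)
    qed
    finally show ?thesis using eq by (simp add: set_integrable_def)
  qed
  show ?thesis
  proof (intro conjI allI impI)
    show "\<exists>I. has_vertical_line_integral (fox_H_integrand p A a q B b x) c I" if "x > 0" "x \<noteq> \<rho>" for x
      using hvli[OF that assms(10)] by blast
    show "fox_H p A a q B b c' x = fox_H p A a q B b c x" if "c' > \<gamma>" "x > 0" "x \<noteq> \<rho>" for c' x
      unfolding H[OF that(2,3,1)] H[OF that(2,3) assms(10)] inversion_def
      by (simp only: deriv_inversion_abscissa[OF that(1) assms(10)])
  qed (use H0 mellin in auto)
qed

end
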